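(* For every $n\ge 5$, the containment $\mathcal B_n\subseteq\mathcal D_n$ is strict; in particular $\mathcal B_5\ne\mathcal D_5$.
   Context: Let $N=\{1,\dots,n\}$. Matrices are complex; positive definite (PD) matrices are Hermitian. For an $n\times n$ matrix $A$ and $S\subseteq N$, $A[S]$ is the principal submatrix in rows and columns $S$, with $\det A[\emptyset]=1$. Given finitely many index sets $\alpha_1,\dots,\alpha_p\subseteq N$ and exponents $\eta_1,\dots,\eta_p>0$ put $\alpha(A)=\prod_{i=1}^p(\det A[\alpha_i])^{\eta_i}$. A ratio $\frac{\alpha}{\beta}$ is the function $A\mapsto \alpha(A)/\beta(A)$ on $n\times n$ PD matrices, for two such products $\alpha,\beta$. It is bounded if it has an upper bound independent of the PD matrix $A$; $\mathcal B_n$ is the set of bounded ratios. The formal logarithm $\log(\frac{\alpha}{\beta})\in\mathbb R^{(2^N)}$ is the vector indexed by the subsets of $N$ whose entry at a nonempty $S$ is the total exponent of $S$ in $\alpha$ minus that in $\beta$, and whose entry at $\emptyset$ is chosen so that all entries sum to $0$. Ratios are identified when they have the same formal logarithm. A ratio is homogeneous if $\alpha(D)/\beta(D)=1$ for every PD diagonal matrix $D$. For a matrix $M$ with $n$ columns, its nullity type $\operatorname{nul}(M)\in\mathbb R^{(2^N)}$ is the vector whose entry at $T\subseteq N$ is the dimension of the null space of the submatrix of $M$ formed by the columns in $T$ (entry $0$ for $T=\emptyset$). $\mathcal D_n$ is the set of homogeneous ratios $\frac{\alpha}{\beta}$ such that $\log(\frac{\alpha}{\beta})^T\nu\ge 0$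 for every nullity type $\nu$ of a matrix with $n$ columns. *)

theory Defs
  imports
    "Jordan_Normal_Form.Determinant"
    "Jordan_Normal_Form.DL_Submatrix"
    "Jordan_Normal_Form.Matrix_Kernel"
    "Jordan_Normal_Form.Schur_Decomposition"
begin

text \<open>Matrices are indexed from 0, so the ground set is \<open>{..<n}\<close> instead of \<open>{1..n}\<close>.\<close>

text \<open>The strict order on complex numbers is that of \<open>HOL-Library.Complex_Order\<close>:
  \<open>0 < z\<close> means that \<open>z\<close> is real and positive.\<close>

definition pos_def :: "nat \<Rightarrow> complex mat \<Rightarrow> bool" where
  "pos_def n A \<longleftrightarrow> A \<in> carrier_mat n n \<and> mat_adjoint A = A \<and>
     (\<forall>v \<in> carrier_vec n. v \<noteq> 0\<^sub>v n \<longrightarrow> 0 < (A *\<^sub>v v) \<bullet>c v)"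

text \<open>A product of powers of principal minors is given by the list of its index sets, each
  with its exponent; a ratio is a pair (numerator, denominator) of such products.\<close>

type_synonym minor_product = "(nat set \<times> real) list"
type_synonym ratio = "minor_product \<times> minor_product"

definition minor_products :: "nat \<Rightarrow> minor_product set" where
  "minor_products n = {\<alpha>. \<forall>(S, \<eta>) \<in> set \<alpha>. S \<subseteq> {..<n} \<and> 0 < \<eta>}"

definition ratios :: "nat \<Rightarrow> ratio set" where
  "ratios n = minor_products n \<times> minor_products n"

text \<open>Only evaluated at positive definite matrices, whose principal minors are real and
  positive, so that taking real parts loses nothing.\<close>

definition product_value :: "minor_product \<Rightarrow> complex mat \<Rightarrow> real" where
  "product_value \<alpha> A = (\<Prod>(S, \<eta>) \<leftarrow> \<alpha>. Re (det (submatrix A S S)) powr \<eta>)"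

definition ratio_value :: "ratio \<Rightarrow> complex mat \<Rightarrow> real" where
  "ratio_value r A = product_value (fst r) A / product_value (snd r) A"

definition bounded_ratio :: "nat \<Rightarrow> ratio \<Rightarrow> bool" where
  "bounded_ratio n r \<longleftrightarrow> (\<exists>C. \<forall>A. pos_def n A \<longrightarrow> ratio_value r A \<le> C)"

definition homogeneous :: "nat \<Rightarrow> ratio \<Rightarrow> bool" where
  "homogeneous n r \<longleftrightarrow> (\<forall>D. pos_def n D \<and> diagonal_mat D \<longrightarrow> ratio_value r D = 1)"

definition total_exponent :: "minor_product \<Rightarrow> nat set \<Rightarrow> real" where
  "total_exponent \<alpha> S = (\<Sum>(T, \<eta>) \<leftarrow> \<alpha>. if T = S then \<eta> else 0)"

text \<open>Vectors indexed by the subsets of the ground set are functions on \<open>nat set\<close>, of which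
  only the values on \<open>Pow {..<n}\<close> matter.\<close>

definition formal_log :: "nat \<Rightarrow> ratio \<Rightarrow> nat set \<Rightarrow> real" where
  "formal_log n r S =
     (if S = {}
      then - (\<Sum>T \<in> Pow {..<n} - {{}}. total_exponent (fst r) T - total_exponent (snd r) T)
      else total_exponent (fst r) S - total_exponent (snd r) S)"

definition same_ratio :: "nat \<Rightarrow> ratio rel" where
  "same_ratio n = {(r, r'). r \<in> ratios n \<and> r' \<in> ratios n \<and>
     (\<forall>S \<in> Pow {..<n}. formal_log n r S = formal_log n r' S)}"

definition nullity_type :: "complex mat \<Rightarrow> nat set \<Rightarrow> real" where
  "nullity_type M T = (if T = {} then 0 else real (kernel_dim (submatrix M UNIV T)))"

definition nullity_nonneg :: "nat \<Rightarrow> ratio \<Rightarrow> bool" where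
  "nullity_nonneg n r \<longleftrightarrow>
     (\<forall>m. \<forall>M \<in> carrier_mat m n. 0 \<le> (\<Sum>T \<in> Pow {..<n}. formal_log n r T * nullity_type M T))"

text \<open>As ratios with the same formal logarithm are identified, the sets of ratios
  \<open>\<B>\<^sub>n\<close> and \<open>\<D>\<^sub>n\<close> consist of equivalence classes.\<close>

definition bounded_ratios :: "nat \<Rightarrow> ratio set set" where
  "bounded_ratios n = {r \<in> ratios n. bounded_ratio n r} // same_ratio n"

definition nullity_ratios :: "nat \<Rightarrow> ratio set set" where
  "nullity_ratios n = {r \<in> ratios n. homogeneous n r \<and> nullity_nonneg n r} // same_ratio n"

end

theory Submission
  imports
    Defs
    "Jordan_Normal_Form.Jordan_Normal_Form_Existence"
    "Jordan_Normal_Form.Jordan_Normal_Form_Uniqueness"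
    "HOL-Library.Function_Algebras"
begin

text \<open>
  \<^bold>\<open>Bounded ratios lie in the nullity cone.\<close>  Replacing the entries \<open>d\<^sub>i\<close> of a positive diagonal
  matrix by \<open>d\<^sub>i powr s\<close> raises the value of a ratio to the power \<open>s\<close>, so a bounded ratio has value 1 on
  it.  For a matrix \<open>M\<close> with \<open>n\<close> columns, the minor of \<open>M\<^sup>* M + t I\<close> on \<open>T\<close> is a polynomial in \<open>t\<close> that
  vanishes at 0 exactly to order \<open>nul(M)\<^sub>T\<close> (lemma \<open>ln_det_gram_shift\<close>): it is the characteristic
  polynomial of a Hermitian matrix, for which algebraic and geometric multiplicity of the eigenvalue 0
  agree.  Hence the logarithm of the ratio, divided by \<open>ln t\<close>, tends to the pairing of
  the formal logarithm with the nullity type; a negative pairing would make the ratio blow up.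

  \<^bold>\<open>Strictness.\<close>  The ratio (with elements \<open>0, ..., 4\<close>, and index sets standing for their minors)
  \<open>01 \<cdot> 2 \<cdot> 03 \<cdot> 124 \<cdot> 34 \<cdot> 01234 / (02 \<cdot> 12 \<cdot> 3 \<cdot> 013 \<cdot> 4 \<cdot> 014 \<cdot> 234)\<close>
  separates the two sets for every \<open>n \<ge> 5\<close>.  Twice its pairing with a nullity function is a sum of
  supermodular inequalities and monotonicity, with a single exception: one unit increment enters in the
  opposite direction.  So the doubled pairing is at least \<open>- 1\<close>, and since nullities are integers the
  pairing itself is nonnegative (lemma \<open>witness_nullity_nonneg\<close>).  

  For a family of positive definite matrices whose minors grow with a parameter \<open>x\<close>, minus half the
  degree of a minor in \<open>x\<close> takes the place of the nullity.  It is still supermodular, but its increments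
  are no longer confined to 0 and 1: in the family below, the increment from \<open>124\<close> to \<open>0124\<close> exceeds the
  one from \<open>4\<close> to \<open>04\<close> by 2.  For the Gram matrix of the vectors
  \<open>e\<^sub>0\<close>, \<open>e\<^sub>1 - x e\<^sub>0\<close>, \<open>e\<^sub>2 - x e\<^sub>0\<close>, \<open>e\<^sub>3 - x e\<^sub>1\<close>, \<open>e\<^sub>4 - x e\<^sub>0 - x e\<^sub>1\<close>
  the ratio grows at least like \<open>x\<^sup>2 / 36\<close> (lemma \<open>witness_growth\<close>).  For \<open>n > 5\<close> the same vectors are
  completed by unit vectors.
\<close>

section \<open>Hermitian and positive definite matrices\<close>

lemma mat_adjoint_carrier [simp]:
  "M \<in> carrier_mat m n \<Longrightarrow> mat_adjoint M \<in> carrier_mat n m"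
  unfolding mat_adjoint_def by (auto simp: mat_of_rows_def)

lemma index_mat_adjoint:
  assumes "M \<in> carrier_mat m n" "i < n" "j < m"
  shows "mat_adjoint M $$ (i, j) = conjugate (M $$ (j, i))"
  using assms by (auto simp: mat_adjoint_def mat_of_rows_def)

lemma cscalar_prod_sum:
  fixes v w :: "complex vec"
  assumes "v \<in> carrier_vec n" "w \<in> carrier_vec n"
  shows "v \<bullet>c w = (\<Sum>i<n. v $ i * cnj (w $ i))"
  using assms by (auto simp: scalar_prod_def atLeast0LessThan)

lemma mult_mat_vec_sum:
  fixes M :: "complex mat"
  assumes "M \<in> carrier_mat m n" "v \<in> carrier_vec n" "i < m"
  shows "(M *\<^sub>v v) $ i = (\<Sum>j<n. M $$ (i, j) * v $ j)"
  using assms by (auto simp: scalar_prod_def atLeast0LessThan intro!: sum.cong)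

lemma adjoint_cscalar_prod:
  fixes M :: "complex mat"
  assumes M: "M \<in> carrier_mat m n" and v: "v \<in> carrier_vec n" and w: "w \<in> carrier_vec m"
  shows "(M *\<^sub>v v) \<bullet>c w = v \<bullet>c (mat_adjoint M *\<^sub>v w)"
proof -
  have "(M *\<^sub>v v) \<bullet>c w = (\<Sum>i<m. (\<Sum>j<n. M $$ (i, j) * v $ j) * cnj (w $ i))"
    using M v w by (subst cscalar_prod_sum[of _ m]) (auto simp: mult_mat_vec_sum[OF M v] simp del: index_mult_mat_vec)
  also have "\<dots> = (\<Sum>j<n. \<Sum>i<m. M $$ (i, j) * v $ j * cnj (w $ i))"
    by (subst sum.swap) (simp add: sum_distrib_right)
  also have "\<dots> = (\<Sum>j<n. v $ j * cnj (\<Sum>i<m. mat_adjoint M $$ (j, i) * w $ i))"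
    by (auto simp: sum_distrib_left index_mat_adjoint[OF M] intro!: sum.cong)
  also have "\<dots> = v \<bullet>c (mat_adjoint M *\<^sub>v w)"
    using M v mult_mat_vec_carrier[OF mat_adjoint_carrier[OF M] w] by (subst cscalar_prod_sum[of _ n])
      (auto simp: mult_mat_vec_sum[OF mat_adjoint_carrier[OF M] w] simp del: index_mult_mat_vec)
  finally show ?thesis .
qed

lemma quadratic_form_sum:
  fixes A :: "complex mat"
  assumes A: "A \<in> carrier_mat n n" and v: "v \<in> carrier_vec n"
  shows "(A *\<^sub>v v) \<bullet>c v = (\<Sum>i<n. \<Sum>j<n. A $$ (i, j) * v $ j * cnj (v $ i))"
  using A v by (subst cscalar_prod_sum[of _ n]) (auto simp: mult_mat_vec_sum[OF A v] sum_distrib_right simp del: index_mult_mat_vec)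

lemma hermitian_index:
  fixes A :: "complex mat"
  assumes "A \<in> carrier_mat n n"
  shows "mat_adjoint A = A \<longleftrightarrow> (\<forall>i<n. \<forall>j<n. A $$ (i, j) = cnj (A $$ (j, i)))"
proof
  assume *: "mat_adjoint A = A"
  show "\<forall>i<n. \<forall>j<n. A $$ (i, j) = cnj (A $$ (j, i))"
    using index_mat_adjoint[OF assms] unfolding * conjugate_complex_def by blast
next
  assume *: "\<forall>i<n. \<forall>j<n. A $$ (i, j) = cnj (A $$ (j, i))"
  show "mat_adjoint A = A"
  proof (rule eq_matI)
    fix i j assume "i < dim_row A" "j < dim_col A"
    then have "i < n" "j < n" using assms by auto
    then show "mat_adjoint A $$ (i, j) = A $$ (i, j)"
      using index_mat_adjoint[OF assms, of i j] *[rule_format, of i j] by simp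
  qed (use assms carrier_matD[OF mat_adjoint_carrier[OF assms]] in auto)
qed

text \<open>\<open>pick S\<close> lists \<open>S\<close> increasingly, which turns sums over the rows of a submatrix into sums over \<open>S\<close>.\<close>

lemma bij_betw_pick:
  assumes "finite S"
  shows "bij_betw (pick S) {..<card S} S"
proof -
  have inj: "inj_on (pick S) {..<card S}"
    proof (rule inj_onI)
    fix i j assume ij: "i \<in> {..<card S}" "j \<in> {..<card S}" "pick S i = pick S j"
    then have "i = card {a \<in> S. a < pick S i}" by (intro card_pick[symmetric]) simp
    also have "\<dots> = card {a \<in> S. a < pick S j}" by (simp only: ij(3))
    also have "\<dots> = j" using ij by (intro card_pick) simp
    finally show "i = j" .
  qed
  have "pick S ` {..<card S} \<subseteq> S" using pick_in_set by blast
  then have "pick S ` {..<card S} = S"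
    using card_image[OF inj] assms by (simp add: card_subset_eq)
  with inj show ?thesis by (simp add: bij_betw_def)
qed

lemma submatrix_carrier:
  assumes "A \<in> carrier_mat n n" "S \<subseteq> {..<n}"
  shows "submatrix A S S \<in> carrier_mat (card S) (card S)"
proof -
  have "{i. i < n \<and> i \<in> S} = S" using assms by auto
  then show ?thesis using assms dim_submatrix[of A S S] by auto
qed

lemma submatrix_nth:
  assumes "A \<in> carrier_mat n n" "S \<subseteq> {..<n}" "i < card S" "j < card S"
  shows "submatrix A S S $$ (i, j) = A $$ (pick S i, pick S j)"
proof -
  have "{i. i < n \<and> i \<in> S} = S" using assms by auto
  then show ?thesis using assms by (subst submatrix_index) auto
qed

text \<open>A vector on \<open>S\<close>, extended by zeros, has the same quadratic form under the full matrix.\<close>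

lemma pos_def_submatrix:
  assumes A: "pos_def n A" and S: "S \<subseteq> {..<n}"
  shows "pos_def (card S) (submatrix A S S)"
proof -
  have carr: "A \<in> carrier_mat n n" and herm: "mat_adjoint A = A" using A by (auto simp: pos_def_def)
  have fin: "finite S" using S finite_subset by blast
  note bij = bij_betw_pick[OF fin]
  let ?B = "submatrix A S S"
  have B: "?B \<in> carrier_mat (card S) (card S)" by (rule submatrix_carrier[OF carr S])
  have less: "pick S i < n" if "i < card S" for i using pick_in_set[of i S] that S by auto
  show ?thesis unfolding pos_def_def
  proof (intro conjI ballI impI B)
    have *: "A $$ (i, j) = cnj (A $$ (j, i))" if "i < n" "j < n" for i j
      using herm that unfolding hermitian_index[OF carr] by blast
    show "mat_adjoint ?B = ?B"
      unfolding hermitian_index[OF B]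
    proof (intro allI impI)
      fix i j assume ij: "i < card S" "j < card S"
      show "?B $$ (i, j) = cnj (?B $$ (j, i))"
        unfolding submatrix_nth[OF carr S ij] submatrix_nth[OF carr S ij(2,1)]
        by (rule *[OF less[OF ij(1)] less[OF ij(2)]])
    qed
  next
    fix v :: "complex vec" assume v: "v \<in> carrier_vec (card S)" and nz: "v \<noteq> 0\<^sub>v (card S)"
    define x where "x = vec n (\<lambda>i. if i \<in> S then v $ card {a \<in> S. a < i} else 0)"
    have x: "x \<in> carrier_vec n" by (simp add: x_def)
    have xp: "x $ pick S i = v $ i" if "i < card S" for i
      using that less[OF that] card_pick[of i S] pick_in_set[of i S] by (simp add: x_def)
    obtain i where i: "i < card S" "v $ i \<noteq> 0" using v nz by (metis carrier_vecD eq_vecI index_zero_vec(1,2))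
    have xnz: "x \<noteq> 0\<^sub>v n" using xp[OF i(1)] i less[OF i(1)] by auto
    have x0: "x $ i = 0" if "i < n" "i \<notin> S" for i using that by (simp add: x_def)
    have "(A *\<^sub>v x) \<bullet>c x = (\<Sum>i<n. \<Sum>j<n. A $$ (i, j) * x $ j * cnj (x $ i))"
      by (rule quadratic_form_sum[OF carr x])
    also have "\<dots> = (\<Sum>i\<in>S. \<Sum>j<n. A $$ (i, j) * x $ j * cnj (x $ i))"
      using S x0 by (intro sum.mono_neutral_right) auto
    also have "\<dots> = (\<Sum>i\<in>S. \<Sum>j\<in>S. A $$ (i, j) * x $ j * cnj (x $ i))"
      using S x0 by (intro sum.cong refl sum.mono_neutral_right) auto
    also have "\<dots> = (\<Sum>i<card S. \<Sum>j<card S. A $$ (pick S i, pick S j) * x $ pick S j * cnj (x $ pick S i))"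
      by (simp add: sum.reindex_bij_betw[OF bij, symmetric])
    also have "\<dots> = (?B *\<^sub>v v) \<bullet>c v"
      unfolding quadratic_form_sum[OF B v] by (auto simp: submatrix_nth[OF carr S] xp intro!: sum.cong)
    finally show "0 < (?B *\<^sub>v v) \<bullet>c v" using A x xnz unfolding pos_def_def by metis
  qed
qed

lemma prod_list_pos:
  fixes zs :: "complex list"
  assumes "\<forall>z \<in> set zs. 0 < z"
  shows "0 < prod_list zs"
  using assms by (induction zs) (auto simp: less_complex_def)

lemma cscalar_self_pos:
  fixes v :: "complex vec"
  assumes "v \<in> carrier_vec n" "v \<noteq> 0\<^sub>v n"
  shows "0 < v \<bullet>c v"
  using conjugate_square_greater_0_vec[OF assms(1)] assms(2) by simp

text \<open>The determinant is the product of the eigenvalues, and the quadratic form at an eigenvector shows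
  each of them to be positive.\<close>

lemma pos_def_det:
  assumes "pos_def n A"
  shows "0 < det A"
proof -
  have A: "A \<in> carrier_mat n n" using assms by (simp add: pos_def_def)
  obtain es where es: "char_poly A = (\<Prod>a\<leftarrow>es. [:- a, 1:])"
    using char_poly_factorized[OF A] by blast
  let ?B = "schur_upper_triangular A es"
  note B = schur_upper_triangular[OF A es]
  have "det A = prod_list (diag_mat ?B)"
    using det_similar[OF B(3)] det_upper_triangular[OF B(2) B(1)] by simp
  moreover have "0 < e" if "e \<in> set (diag_mat ?B)" for e
  proof -
    have "char_poly A = (\<Prod>a\<leftarrow>diag_mat ?B. [:- a, 1:])"
      using char_poly_similar[OF B(3)] char_poly_upper_triangular[OF B(1,2)] by simp
    then have "poly (char_poly A) e = 0" using that by (auto simp: poly_prod_list prod_list_zero_iff)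
    then have "eigenvalue A e" by (simp add: eigenvalue_root_char_poly[OF A])
    then obtain v where v: "v \<in> carrier_vec n" "v \<noteq> 0\<^sub>v n" "A *\<^sub>v v = e \<cdot>\<^sub>v v"
      using A by (auto simp: eigenvalue_def eigenvector_def)
    have pos: "0 < (A *\<^sub>v v) \<bullet>c v" using assms v(1,2) unfolding pos_def_def by blast
    have "(A *\<^sub>v v) \<bullet>c v = e * (v \<bullet>c v)" using v by simp
    with pos cscalar_self_pos[OF v(1,2)] show "0 < e"
      by (auto simp: less_complex_def zero_less_mult_iff)
  qed
  ultimately show ?thesis using prod_list_pos by simp
qed

lemma pos_def_minor:
  assumes "pos_def n A" "S \<subseteq> {..<n}"
  shows "0 < Re (det (submatrix A S S))"
  using pos_def_det[OF pos_def_submatrix[OF assms]] by (simp add: less_complex_def)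

lemma minor_empty: "det (submatrix A {} {}) = 1"
  by (simp add: submatrix_def det_dim_zero)

section \<open>Vanishing order of the determinant of a shifted Gram matrix\<close>

lemma kernel_dim_eqI:
  assumes "dim_col A = dim_col B" "mat_kernel A = mat_kernel B"
  shows "kernel_dim A = kernel_dim B"
  using assms by (simp add: kernel_dim_def)

lemma pow_mat_Suc_left:
  fixes H :: "'a :: semiring_1 mat"
  assumes H: "H \<in> carrier_mat n n"
  shows "H ^\<^sub>m Suc j = H * H ^\<^sub>m j"
proof (induction j)
  case (Suc j)
  have "H ^\<^sub>m Suc (Suc j) = (H * H ^\<^sub>m j) * H" using Suc.IH by simp
  also have "\<dots> = H * (H ^\<^sub>m j * H)" by (rule assoc_mult_mat[OF H _ H]) (use H in simp)
  finally show ?case by simp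
qed (use H in simp)

text \<open>If \<open>H (H w) = 0\<close> then the squared length of \<open>H w\<close> is \<open>w \<bullet> H (H w) = 0\<close>: a Hermitian matrix has no
  generalized null vectors beyond its null vectors.\<close>

lemma hermitian_pow_kernel:
  fixes H :: "complex mat"
  assumes H: "H \<in> carrier_mat n n" and herm: "mat_adjoint H = H"
  shows "mat_kernel (H ^\<^sub>m Suc k) = mat_kernel H"
proof (induction k)
  case (Suc k)
  have pow: "H ^\<^sub>m j \<in> carrier_mat n n" for j using H by simp
  have "mat_kernel (H ^\<^sub>m Suc (Suc k)) = mat_kernel (H ^\<^sub>m Suc k)"
  proof (intro equalityI subsetI)
    fix v assume "v \<in> mat_kernel (H ^\<^sub>m Suc (Suc k))"
    note v = mat_kernelD[OF pow this]
    define w where "w = H ^\<^sub>m k *\<^sub>v v"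
    have w: "w \<in> carrier_vec n" unfolding w_def using pow[of k] v(1) by simp
    have comm: "H ^\<^sub>m Suc j = H * H ^\<^sub>m j" for j by (rule pow_mat_Suc_left[OF H])
    have Hw: "H ^\<^sub>m Suc k *\<^sub>v v = H *\<^sub>v w"
      unfolding w_def comm by (rule assoc_mult_mat_vec[OF H pow v(1)])
    have "H *\<^sub>v (H *\<^sub>v w) = 0\<^sub>v n"
      using v(2) unfolding comm[of "Suc k"] Hw[symmetric] using assoc_mult_mat_vec[OF H pow v(1)] by metis
    then have "(H *\<^sub>v w) \<bullet>c (H *\<^sub>v w) = 0"
      using adjoint_cscalar_prod[OF H w, of "H *\<^sub>v w"] H w herm by simp
    then have "H *\<^sub>v w = 0\<^sub>v n" using conjugate_square_eq_0_vec[of "H *\<^sub>v w" n] H w by simp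
    then show "v \<in> mat_kernel (H ^\<^sub>m Suc k)" using Hw v(1) by (intro mat_kernelI[OF pow]) auto
  next
    fix v assume "v \<in> mat_kernel (H ^\<^sub>m Suc k)"
    note v = mat_kernelD[OF pow this]
    have "H ^\<^sub>m Suc (Suc k) *\<^sub>v v = H *\<^sub>v (H ^\<^sub>m Suc k *\<^sub>v v)"
      unfolding pow_mat_Suc_left[OF H, of "Suc k"] by (rule assoc_mult_mat_vec[OF H pow v(1)])
    also have "\<dots> = 0\<^sub>v n" unfolding v(2) using H by auto
    finally show "v \<in> mat_kernel (H ^\<^sub>m Suc (Suc k))" using v(1) by (intro mat_kernelI[OF pow])
  qed
  with Suc.IH show ?case by simp
qed (use H in simp)

text \<open>The order of the root 0 is the sum of the sizes of the Jordan blocks for 0, which is the dimension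
  of the kernel of a high power of \<open>H\<close>.\<close>

lemma hermitian_order_char_poly:
  fixes H :: "complex mat"
  assumes H: "H \<in> carrier_mat n n" and herm: "mat_adjoint H = H"
  shows "Polynomial.order 0 (char_poly H) = kernel_dim H"
proof -
  obtain n_as where jnf: "jordan_nf H n_as"
    using char_poly_factorized[OF H] jordan_nf_iff_linear_factorization[OF H] by blast
  define L where "L = map fst (filter (\<lambda>na. snd na = 0) n_as)"
  \<comment> \<open>\<open>Suc k\<close> exceeds the size of every block\<close>
  define k where "k = sum_list L"
  have char0: "char_matrix H 0 = H" using H by (auto simp: char_matrix_def)
  have dim: "dim_gen_eigenspace H 0 (Suc j) = kernel_dim H" for j
    unfolding dim_gen_eigenspace_def char0
    by (rule kernel_dim_eqI[OF _ hermitian_pow_kernel[OF H herm]]) (use H in \<open>simp add: pow_mat_dim\<close>)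
  have L_eq: "map fst [(n, e)\<leftarrow>n_as . e = 0] = L"
    unfolding L_def by (simp add: case_prod_beta')
  have "(\<Sum>n\<leftarrow>L. min (Suc k) n) = sum_list L"
    unfolding k_def using member_le_sum_list[of _ L]
    by (intro arg_cong[of _ _ sum_list] map_idI) (simp add: le_SucI min_absorb2)
  then show ?thesis
    using jordan_nf_order[OF jnf, of 0] dim_gen_eigenspace[OF jnf, of 0 "Suc k"] dim[of k]
    unfolding L_eq by (simp add: L_def)
qed

definition gram_shift :: "nat \<Rightarrow> complex mat \<Rightarrow> real \<Rightarrow> complex mat" where
  "gram_shift n M t = mat_adjoint M * M + complex_of_real t \<cdot>\<^sub>m 1\<^sub>m n"

lemma mat_adjoint_gram:
  assumes M: "M \<in> carrier_mat m n"
  shows "mat_adjoint M * M \<in> carrier_mat n n"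
  by (rule mult_carrier_mat[OF mat_adjoint_carrier[OF M] M])

lemma gram_index:
  fixes M :: "complex mat"
  assumes M: "M \<in> carrier_mat m n" and ij: "i < n" "j < n"
  shows "(mat_adjoint M * M) $$ (i, j) = (\<Sum>k<m. cnj (M $$ (k, i)) * M $$ (k, j))"
proof -
  have "(mat_adjoint M * M) $$ (i, j) = row (mat_adjoint M) i \<bullet> col M j"
    using ij carrier_matD[OF M] carrier_matD[OF mat_adjoint_carrier[OF M]] by (intro index_mult_mat(1)) simp_all
  also have "\<dots> = (\<Sum>k<m. mat_adjoint M $$ (i, k) * M $$ (k, j))"
    using ij M carrier_matD[OF mat_adjoint_carrier[OF M]]
    by (auto simp: scalar_prod_def atLeast0LessThan)
  finally show ?thesis using ij by (simp add: index_mat_adjoint[OF M])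
qed

lemma gram_hermitian:
  fixes M :: "complex mat"
  assumes M: "M \<in> carrier_mat m n"
  shows "mat_adjoint (mat_adjoint M * M) = mat_adjoint M * M"
  unfolding hermitian_index[OF mat_adjoint_gram[OF M]]
proof (intro allI impI)
  fix i j assume "i < n" "j < n"
  then show "(mat_adjoint M * M) $$ (i, j) = cnj ((mat_adjoint M * M) $$ (j, i))"
    unfolding gram_index[OF M \<open>i < n\<close> \<open>j < n\<close>] gram_index[OF M \<open>j < n\<close> \<open>i < n\<close>]
    by (simp add: mult.commute)
qed

lemma gram_quadratic:
  fixes M :: "complex mat"
  assumes M: "M \<in> carrier_mat m n" and v: "v \<in> carrier_vec n"
  shows "((mat_adjoint M * M) *\<^sub>v v) \<bullet>c v = (M *\<^sub>v v) \<bullet>c (M *\<^sub>v v)"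
proof -
  have G: "mat_adjoint M * M *\<^sub>v v = mat_adjoint M *\<^sub>v (M *\<^sub>v v)"
    by (rule assoc_mult_mat_vec[OF mat_adjoint_carrier[OF M] M v])
  have Mv: "M *\<^sub>v v \<in> carrier_vec m" using M v by simp
  have Gv: "mat_adjoint M * M *\<^sub>v v \<in> carrier_vec n" using mat_adjoint_gram[OF M] v by simp
  have "(mat_adjoint M * M *\<^sub>v v) \<bullet>c v = v \<bullet>c (mat_adjoint M * M *\<^sub>v v)"
    using adjoint_cscalar_prod[OF mat_adjoint_gram[OF M] v v] gram_hermitian[OF M] by simp
  also have "\<dots> = (M *\<^sub>v v) \<bullet>c (M *\<^sub>v v)"
    unfolding G using adjoint_cscalar_prod[OF M v Mv] by simp
  finally show ?thesis .
qed

lemma gram_kernel_dim: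
  fixes M :: "complex mat"
  assumes M: "M \<in> carrier_mat m n"
  shows "kernel_dim (- (mat_adjoint M * M)) = kernel_dim M"
proof (rule kernel_dim_eqI)
  note G = mat_adjoint_gram[OF M]
  have nG: "- (mat_adjoint M * M) \<in> carrier_mat n n" using G by simp
  show "dim_col (- (mat_adjoint M * M)) = dim_col M" using nG M by simp
  have uminus: "- (mat_adjoint M * M) *\<^sub>v v = - (mat_adjoint M * M *\<^sub>v v)" if "v \<in> carrier_vec n" for v
    using G that by (intro eq_vecI) (auto simp: scalar_prod_def sum_negf)
  show "mat_kernel (- (mat_adjoint M * M)) = mat_kernel M"
  proof (intro equalityI subsetI)
    fix v assume "v \<in> mat_kernel (- (mat_adjoint M * M))"
    note v = mat_kernelD[OF nG this]
    have "mat_adjoint M * M *\<^sub>v v = 0\<^sub>v n"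
      using v uminus[OF v(1)] G by (metis mult_mat_vec_carrier uminus_uminus_vec uminus_zero_vec)
    then have "(M *\<^sub>v v) \<bullet>c (M *\<^sub>v v) = 0" using gram_quadratic[OF M v(1)] v(1) by simp
    then have "M *\<^sub>v v = 0\<^sub>v m" using conjugate_square_eq_0_vec[of "M *\<^sub>v v" m] M v(1) by simp
    then show "v \<in> mat_kernel M" using v(1) by (intro mat_kernelI[OF M])
  next
    fix v assume "v \<in> mat_kernel M"
    note v = mat_kernelD[OF M this]
    have "mat_adjoint M * M *\<^sub>v v = mat_adjoint M *\<^sub>v (M *\<^sub>v v)"
      by (rule assoc_mult_mat_vec[OF mat_adjoint_carrier[OF M] M v(1)])
    also have "\<dots> = 0\<^sub>v n" unfolding v(2) using mat_adjoint_carrier[OF M] by auto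
    finally show "v \<in> mat_kernel (- (mat_adjoint M * M))"
      using v(1) by (intro mat_kernelI[OF nG]) (auto simp: uminus)
  qed
qed

text \<open>The quadratic form at \<open>v\<close> is the squared length of \<open>M v\<close> plus \<open>t\<close> times that of \<open>v\<close>.  The case \<open>t = 0\<close> serves
  for Gram matrices of independent columns, the case \<open>t > 0\<close> for arbitrary \<open>M\<close>.\<close>

lemma pos_def_gram_shift:
  assumes M: "M \<in> carrier_mat m n" and t: "0 \<le> t" and triv: "t = 0 \<Longrightarrow> mat_kernel M \<subseteq> {0\<^sub>v n}"
  shows "pos_def n (gram_shift n M t)"
  unfolding pos_def_def
proof (intro conjI ballI impI)
  note G = mat_adjoint_gram[OF M]
  show carr: "gram_shift n M t \<in> carrier_mat n n" using G by (simp add: gram_shift_def)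
  show "mat_adjoint (gram_shift n M t) = gram_shift n M t"
    unfolding hermitian_index[OF carr]
  proof (intro allI impI)
    fix i j assume ij: "i < n" "j < n"
    have sym: "cnj ((mat_adjoint M * M) $$ (j, i)) = (mat_adjoint M * M) $$ (i, j)"
      using gram_hermitian[OF M] ij unfolding hermitian_index[OF G] by metis
    show "gram_shift n M t $$ (i, j) = cnj (gram_shift n M t $$ (j, i))"
      using ij carrier_matD[OF G] unfolding gram_shift_def
      by (simp del: index_mult_mat(1) add: complex_cnj_add sym)
  qed
  fix v :: "complex vec" assume v: "v \<in> carrier_vec n" and nz: "v \<noteq> 0\<^sub>v n"
  have one: "(complex_of_real t \<cdot>\<^sub>m 1\<^sub>m n) *\<^sub>v v = complex_of_real t \<cdot>\<^sub>v v"
    by (rule eq_vecI) (use v in auto)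
  have "gram_shift n M t *\<^sub>v v = mat_adjoint M * M *\<^sub>v v + complex_of_real t \<cdot>\<^sub>v v"
    unfolding gram_shift_def one[symmetric] by (rule add_mult_distrib_mat_vec[OF G _ v]) simp
  then have "(gram_shift n M t *\<^sub>v v) \<bullet>c v = (mat_adjoint M * M *\<^sub>v v) \<bullet>c v + t * (v \<bullet>c v)"
    using v G mult_mat_vec_carrier[OF G v] by (simp add: add_scalar_prod_distrib[of _ n])
  then have eq: "(gram_shift n M t *\<^sub>v v) \<bullet>c v = (M *\<^sub>v v) \<bullet>c (M *\<^sub>v v) + t * (v \<bullet>c v)"
    using gram_quadratic[OF M v] by simp
  have ge: "0 \<le> (M *\<^sub>v v) \<bullet>c (M *\<^sub>v v)" by (rule conjugate_square_ge_0_vec)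
  show "0 < (gram_shift n M t *\<^sub>v v) \<bullet>c v"
  proof (cases "t = 0")
    case False
    then show ?thesis unfolding eq using ge t cscalar_self_pos[OF v nz]
      by (auto simp: less_complex_def less_eq_complex_def add_nonneg_pos)
  next
    case True
    have "M *\<^sub>v v \<noteq> 0\<^sub>v m" using triv[OF True] nz v mat_kernelI[OF M v] by auto
    then show ?thesis unfolding eq using True cscalar_self_pos[of "M *\<^sub>v v" m] M v by simp
  qed
qed

text \<open>The determinant is the value at \<open>t\<close> of the characteristic polynomial of \<open>- M\<^sup>* M\<close>, a matrix with the
  kernel of \<open>M\<close>.\<close>

lemma det_gram_shift_order:
  assumes M: "M \<in> carrier_mat m n"
  obtains q where "poly q 0 \<noteq> 0" "\<And>t. det (gram_shift n M t) = of_real t ^ kernel_dim M * poly q (of_real t)"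
proof -
  note G = mat_adjoint_gram[OF M]
  define H where "H = - (mat_adjoint M * M)"
  have H: "H \<in> carrier_mat n n" using G by (simp add: H_def)
  have herm: "mat_adjoint H = H"
    unfolding hermitian_index[OF H]
  proof (intro allI impI)
    fix i j assume ij: "i < n" "j < n"
    have sym: "cnj ((mat_adjoint M * M) $$ (j, i)) = (mat_adjoint M * M) $$ (i, j)"
      using gram_hermitian[OF M] ij unfolding hermitian_index[OF G] by metis
    show "H $$ (i, j) = cnj (H $$ (j, i))"
      using ij carrier_matD[OF G] unfolding H_def by (simp del: index_mult_mat(1) add: sym)
  qed
  have nz: "char_poly H \<noteq> 0" using degree_monic_char_poly[OF H] by auto
  obtain q where q: "char_poly H = [:- 0, 1:] ^ Polynomial.order 0 (char_poly H) * q" "\<not> [:- 0, 1:] dvd q"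
    using order_decomp[OF nz] by blast
  show thesis
  proof
    show "poly q 0 \<noteq> 0" using q(2) by (simp add: poly_eq_0_iff_dvd)
    fix t :: real
    have "- char_matrix H (of_real t) = gram_shift n M t"
      using carrier_matD[OF G]
      by (intro eq_matI) (auto simp: char_matrix_def H_def gram_shift_def simp del: index_mult_mat)
    then have "det (gram_shift n M t) = poly (char_poly H) (of_real t)"
      by (simp add: char_poly_matrix[OF H])
    also have "\<dots> = of_real t ^ kernel_dim M * poly q (of_real t)"
      by (subst q(1)) (simp add: hermitian_order_char_poly[OF H herm] gram_kernel_dim[OF M, folded H_def])
    finally show "det (gram_shift n M t) = of_real t ^ kernel_dim M * poly q (of_real t)" .
  qed
qed

text \<open>The cofactor of \<open>t\<close> to the power \<open>kernel_dim M\<close> is positive for \<open>t > 0\<close> and nonzero at 0, so its limit is positive and its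
  logarithm stays bounded.\<close>

lemma ln_det_gram_shift:
  assumes M: "M \<in> carrier_mat m n"
  shows "((\<lambda>t. ln (Re (det (gram_shift n M t))) / ln t) \<longlongrightarrow> kernel_dim M) (at_right 0)"
proof -
  let ?k = "kernel_dim M"
  obtain q where q0: "poly q 0 \<noteq> 0"
    and q: "\<And>t. det (gram_shift n M t) = of_real t ^ ?k * poly q (of_real t)"
    using det_gram_shift_order[OF M] by blast
  have pos: "0 < poly q (of_real t)" if "0 < t" for t :: real
  proof -
    have "0 < det (gram_shift n M t)" using that by (intro pos_def_det[OF pos_def_gram_shift[OF M]]) auto
    then show ?thesis using that unfolding q
      by (simp add: less_complex_def zero_less_mult_iff flip: of_real_power)
  qed
  have lim: "((\<lambda>t. poly q (complex_of_real t)) \<longlongrightarrow> poly q (complex_of_real 0)) (at_right 0)"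
    by (intro tendsto_intros)
  have ev: "\<forall>\<^sub>F t in at_right (0::real). 0 < t" by (simp add: eventually_at_right_less)
  have "Im (poly q 0) = 0"
  proof -
    have *: "((\<lambda>t. Im (poly q (complex_of_real t))) \<longlongrightarrow> Im (poly q (complex_of_real 0))) (at_right 0)"
      by (intro tendsto_Im lim)
    have "\<forall>\<^sub>F t in at_right 0. Im (poly q (complex_of_real t)) = 0"
      using ev by eventually_elim (use pos in \<open>auto simp: less_complex_def\<close>)
    then show ?thesis
      using tendsto_unique[OF trivial_limit_at_right_real * tendsto_eventually] by simp
  qed
  moreover have limRe: "((\<lambda>t. Re (poly q (complex_of_real t))) \<longlongrightarrow> Re (poly q 0)) (at_right 0)"
    using tendsto_Re[OF lim] by simp
  moreover have "0 \<le> Re (poly q 0)"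
    by (rule tendsto_lowerbound[OF limRe])
      (use ev in eventually_elim, use pos in \<open>auto simp: less_complex_def intro: less_imp_le\<close>)
  ultimately have "0 < Re (poly q 0)" using q0 by (auto simp: complex_eq_iff less_le)
  then have "((\<lambda>t. ln (Re (poly q (complex_of_real t)))) \<longlongrightarrow> ln (Re (poly q 0))) (at_right 0)"
    by (intro tendsto_ln limRe) auto
  moreover have "filterlim (\<lambda>t::real. ln t) at_bot (at_right 0)" by (rule ln_at_0)
  ultimately have "((\<lambda>t. ln (Re (poly q (complex_of_real t))) / ln t) \<longlongrightarrow> 0) (at_right 0)"
    using tendsto_divide_0 filterlim_mono at_bot_le_at_infinity by blast
  then have "((\<lambda>t. real ?k + ln (Re (poly q (complex_of_real t))) / ln t) \<longlongrightarrow> real ?k + 0) (at_right 0)"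
    by (intro tendsto_intros)
  moreover have ev01: "\<forall>\<^sub>F t in at_right (0::real). t \<in> {0<..<1}"
    by (rule eventually_at_right_real) simp
  have "\<forall>\<^sub>F t in at_right 0. real ?k + ln (Re (poly q (complex_of_real t))) / ln t
      = ln (Re (det (gram_shift n M t))) / ln t"
    using ev01
  proof eventually_elim
    case (elim t)
    then have t: "0 < t" "t < 1" "ln t \<noteq> 0" by auto
    have "Re (det (gram_shift n M t)) = t ^ ?k * Re (poly q (of_real t))"
      unfolding q by (simp flip: of_real_power)
    then show ?case using t pos[OF t(1)]
      by (simp add: ln_mult less_complex_def ln_realpow add_divide_distrib)
  qed
  ultimately show ?thesis using tendsto_cong by force
qed

section \<open>Nullity as a set function\<close>

text \<open>The null space on the columns \<open>S\<close> is modelled inside one fixed vector space, as functions supported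
  in \<open>S\<close>.  The null spaces for different \<open>S\<close> are then nested, while the kernels of the submatrices live
  in spaces of different dimensions.\<close>

interpretation cfun: vector_space "\<lambda>(c::complex) (f::nat \<Rightarrow> complex) i. c * f i"
  by unfold_locales (auto simp: fun_eq_iff algebra_simps)

definition null_funs :: "complex mat \<Rightarrow> nat set \<Rightarrow> (nat \<Rightarrow> complex) set" where
  "null_funs M S = {f. (\<forall>i. i \<notin> S \<longrightarrow> f i = 0) \<and> (\<forall>r<dim_row M. (\<Sum>j<dim_col M. M $$ (r, j) * f j) = 0)}"

lemma subspace_null_funs: "cfun.subspace (null_funs M S)"
  unfolding cfun.subspace_def null_funs_def
  by (auto simp: distrib_left sum.distrib mult.left_commute sum_distrib_left[symmetric])

lemma null_funs_mono: "S \<subseteq> T \<Longrightarrow> null_funs M S \<subseteq> null_funs M T"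
  by (auto simp: null_funs_def)

lemma null_funs_insertD: "f \<in> null_funs M (insert i S) \<Longrightarrow> f i = 0 \<Longrightarrow> f \<in> null_funs M S"
  by (auto simp: null_funs_def)

lemma null_funs_basis:
  assumes "finite S"
  obtains B where "finite B" "B \<subseteq> null_funs M S" "cfun.independent B" "cfun.span B = null_funs M S"
    "card B = cfun.dim (null_funs M S)"
proof -
  obtain B where B: "B \<subseteq> null_funs M S" "cfun.independent B" "null_funs M S \<subseteq> cfun.span B"
    "card B = cfun.dim (null_funs M S)"
    using cfun.basis_exists by blast
  define E where "E = (\<lambda>i j. if j = i then 1 else (0::complex)) ` S"
  have "null_funs M S \<subseteq> cfun.span E"
  proof
    fix f assume f: "f \<in> null_funs M S"
    have "f = (\<Sum>i\<in>S. (\<lambda>j. f i * (if j = i then 1 else 0)))"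
    proof
      fix j
      have "(\<Sum>i\<in>S. (\<lambda>j. f i * (if j = i then 1 else 0))) j = (\<Sum>i\<in>S. f i * (if j = i then 1 else 0))"
        using assms by (induction S rule: finite_induct) auto
      also have "\<dots> = (\<Sum>i\<in>S. if i = j then f i else 0)" by (intro sum.cong) auto
      also have "\<dots> = f j" using f assms by (auto simp: null_funs_def)
      finally show "f j = (\<Sum>i\<in>S. (\<lambda>j. f i * (if j = i then 1 else 0))) j" by simp
    qed
    also have "\<dots> \<in> cfun.span E"
      by (intro cfun.span_sum cfun.span_scale cfun.span_base) (auto simp: E_def)
    finally show "f \<in> cfun.span E" .
  qed
  then have "finite B"
    using cfun.independent_span_bound[of E B] B assms by (auto simp: E_def)
  moreover have "cfun.span B = null_funs M S"
    using B cfun.span_minimal[OF B(1) subspace_null_funs] by blast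
  ultimately show thesis using that B by blast
qed

text \<open>A new column raises the nullity by one exactly if it is a combination of the old columns, that is,
  if some null function does not vanish there.  Such a function together with a basis of the old null
  space is a basis of the new one.  As this condition is monotone in \<open>S\<close>, it yields both the unit
  increments and supermodularity.\<close>

lemma dim_null_funs_insert:
  assumes "finite S" "i \<notin> S"
  shows "cfun.dim (null_funs M (insert i S)) =
    cfun.dim (null_funs M S) + (if \<exists>f \<in> null_funs M (insert i S). f i \<noteq> 0 then 1 else 0)"
proof (cases "\<exists>f \<in> null_funs M (insert i S). f i \<noteq> 0")
  case False
  then have "null_funs M (insert i S) = null_funs M S" by (auto simp: null_funs_def)
  with False show ?thesis by simp
next
  case True
  then obtain f where f: "f \<in> null_funs M (insert i S)" "f i \<noteq> 0" by blast
  obtain B where B: "finite B" "B \<subseteq> null_funs M S" "cfun.independent B" "cfun.span B = null_funs M S"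
    "card B = cfun.dim (null_funs M S)"
    using null_funs_basis[OF assms(1)] by blast
  have fB: "f \<notin> cfun.span B" unfolding B(4) using f assms(2) by (auto simp: null_funs_def)
  have "cfun.dim (null_funs M (insert i S)) = card (insert f B)"
  proof (rule cfun.dim_unique[OF _ _ _ refl])
    show "insert f B \<subseteq> null_funs M (insert i S)"
      using f(1) B(2) null_funs_mono[of S "insert i S" M] by blast
    show "cfun.independent (insert f B)" using cfun.independent_insertI[OF fB B(3)] .
    show "null_funs M (insert i S) \<subseteq> cfun.span (insert f B)"
    proof
      fix g assume g: "g \<in> null_funs M (insert i S)"
      define c where "c = g i / f i"
      have "g - (\<lambda>j. c * f j) \<in> null_funs M (insert i S)"
        by (rule cfun.subspace_diff[OF subspace_null_funs g cfun.subspace_scale[OF subspace_null_funs f(1)]])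
      moreover have "(g - (\<lambda>j. c * f j)) i = 0" using f(2) by (simp add: c_def)
      ultimately have "g - (\<lambda>j. c * f j) \<in> cfun.span B"
        unfolding B(4) by (rule null_funs_insertD)
      then show "g \<in> cfun.span (insert f B)" unfolding cfun.span_breakdown_eq by blast
    qed
  qed
  also have "\<dots> = card B + 1"
    using B(1) fB cfun.span_base[of f B] by (subst card_insert_disjoint) auto
  finally show ?thesis unfolding B(5) if_P[OF True] .
qed

lemma submatrix_cols:
  assumes M: "M \<in> carrier_mat m n" and S: "S \<subseteq> {..<n}"
  shows "submatrix M UNIV S \<in> carrier_mat m (card S)"
    and "\<And>r j. r < m \<Longrightarrow> j < card S \<Longrightarrow> submatrix M UNIV S $$ (r, j) = M $$ (r, pick S j)"
proof -
  have *: "{i. i < n \<and> i \<in> S} = S" "{i. i < m \<and> i \<in> UNIV} = {..<m}" using S by auto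
  show "submatrix M UNIV S \<in> carrier_mat m (card S)"
    by (rule carrier_matI) (simp_all only: dim_submatrix carrier_matD[OF M] * card_lessThan)
  show "submatrix M UNIV S $$ (r, j) = M $$ (r, pick S j)" if "r < m" "j < card S" for r j
    using that by (subst submatrix_index) (simp_all only: carrier_matD[OF M] * card_lessThan pick_UNIV)
qed

text \<open>Extension by zero carries a basis of the kernel of the submatrix to a basis of \<open>null_funs M S\<close>.\<close>

lemma kernel_dim_null_funs:
  assumes M: "M \<in> carrier_mat m n" and S: "S \<subseteq> {..<n}"
  shows "kernel_dim (submatrix M UNIV S) = cfun.dim (null_funs M S)"
proof -
  define N where "N = submatrix M UNIV S"
  define k where "k = card S"
  have N: "N \<in> carrier_mat m k" and N_nth: "\<And>r j. r < m \<Longrightarrow> j < k \<Longrightarrow> N $$ (r, j) = M $$ (r, pick S j)"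
    using submatrix_cols[OF M S] by (auto simp: N_def k_def)
  have fin: "finite S" using S finite_subset by blast
  note bij = bij_betw_pick[OF fin, folded k_def]
  define ext where "ext = (\<lambda>(v :: complex vec) i. if i \<in> S then v $ card {a \<in> S. a < i} else 0)"
  have ext_pick: "ext v (pick S i) = v $ i" if "i < k" for v i
    using that card_pick[of i S] pick_in_set[of i S] by (simp add: ext_def k_def)
  have ext_out: "ext v i = 0" if "i \<notin> S" for v i using that by (simp add: ext_def)
  have sum_eq: "(\<Sum>j<n. M $$ (r, j) * ext v j) = (N *\<^sub>v v) $ r" if "v \<in> carrier_vec k" "r < m" for v r
  proof -
    have "(\<Sum>j<n. M $$ (r, j) * ext v j) = (\<Sum>j\<in>S. M $$ (r, j) * ext v j)"
      using S ext_out by (intro sum.mono_neutral_right) auto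
    also have "\<dots> = (\<Sum>j<k. M $$ (r, pick S j) * ext v (pick S j))"
      by (simp add: sum.reindex_bij_betw[OF bij, symmetric])
    also have "\<dots> = (N *\<^sub>v v) $ r"
      unfolding mult_mat_vec_sum[OF N that] using that by (auto simp: N_nth ext_pick intro!: sum.cong)
    finally show ?thesis .
  qed
  have ext_null: "ext v \<in> null_funs M S \<longleftrightarrow> v \<in> mat_kernel N" if v: "v \<in> carrier_vec k" for v
  proof -
    have "ext v \<in> null_funs M S \<longleftrightarrow> (\<forall>r<m. (N *\<^sub>v v) $ r = 0)"
      using M ext_out sum_eq[OF v] by (auto simp: null_funs_def simp del: index_mult_mat_vec)
    also have "\<dots> \<longleftrightarrow> v \<in> mat_kernel N"
      unfolding mat_kernel[OF N] using N v by (auto simp: vec_eq_iff simp del: index_mult_mat_vec)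
    finally show ?thesis .
  qed
  interpret K: kernel m k N by unfold_locales (rule N)
  obtain B where B: "finite B" "K.basis B" using kernel_basis_exists[OF N] by blast
  have Bk: "B \<subseteq> mat_kernel N" and ind: "\<not> K.lin_dep B" and gen: "K.span B = mat_kernel N"
    using B(2) unfolding K.Ker.basis_def by auto
  have kc: "v \<in> carrier_vec k" if "v \<in> mat_kernel N" for v using mat_kernelD[OF N that] by simp
  have inj: "inj_on ext (carrier_vec k)"
    by (rule inj_onI, rule eq_vecI) (metis carrier_vecD ext_pick, auto)
  have injB: "inj_on ext B" by (rule inj_on_subset[OF inj]) (use Bk kc in blast)
  have lin: "(\<Sum>x\<in>A. (\<lambda>i. a x * ext x i)) = ext (K.lincomb a A)" if A: "finite A" "A \<subseteq> B" for a A
  proof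
    fix i
    have app: "(\<Sum>x\<in>A. (\<lambda>i. a x * ext x i)) i = (\<Sum>x\<in>A. a x * ext x i)"
      using A(1) by (induction A rule: finite_induct) auto
    show "(\<Sum>x\<in>A. (\<lambda>i. a x * ext x i)) i = ext (K.lincomb a A) i"
    proof (cases "i \<in> S")
      case True
      then obtain j where j: "j < k" "i = pick S j" using bij by (auto simp: bij_betw_def)
      have "K.lincomb a A $ j = (\<Sum>x\<in>A. a x * x $ j)"
        by (rule K.lincomb_index[OF j(1)]) (use A Bk in blast)
      then show ?thesis unfolding app unfolding j(2) by (simp add: ext_pick[OF j(1)])
    qed (simp add: app ext_out)
  qed
  have "cfun.dim (null_funs M S) = card (ext ` B)"
  proof (rule cfun.dim_unique[OF _ _ _ refl])
    show "ext ` B \<subseteq> null_funs M S" using ext_null Bk kc by blast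
    show "null_funs M S \<subseteq> cfun.span (ext ` B)"
    proof
      fix f assume f: "f \<in> null_funs M S"
      define v where "v = vec k (\<lambda>i. f (pick S i))"
      have v: "v \<in> carrier_vec k" by (simp add: v_def)
      have "ext v i = f i" for i
      proof (cases "i \<in> S")
        case True
        then obtain j where j: "j < k" "i = pick S j" using bij by (auto simp: bij_betw_def)
        show ?thesis unfolding j(2) ext_pick[OF j(1)] using j(1) by (simp add: v_def)
      next
        case False
        then show ?thesis using f by (auto simp: null_funs_def ext_out)
      qed
      then have fv: "f = ext v" by auto
      then have "v \<in> K.span B" using f ext_null[OF v] gen by simp
      then obtain a A where A: "finite A" "A \<subseteq> B" "v = K.lincomb a A"
        unfolding K.Ker.span_def by blast
      have "f = (\<Sum>x\<in>A. (\<lambda>i. a x * ext x i))" unfolding fv A(3) lin[OF A(1,2)] ..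
      also have "\<dots> \<in> cfun.span (ext ` B)"
        using A(2) by (intro cfun.span_sum cfun.span_scale cfun.span_base) auto
      finally show "f \<in> cfun.span (ext ` B)" .
    qed
    show "cfun.independent (ext ` B)"
      unfolding cfun.dependent_finite[OF finite_imageI[OF B(1)]]
    proof (rule notI, elim exE conjE bexE)
      fix u w assume w: "w \<in> ext ` B" "u w \<noteq> 0" and u: "(\<Sum>v\<in>ext ` B. (\<lambda>i. u v * v i)) = 0"
      then obtain b where b: "b \<in> B" "w = ext b" by blast
      have "ext (K.lincomb (u \<circ> ext) B) = 0"
        using u lin[OF B(1) order_refl, of "u \<circ> ext"] by (simp add: sum.reindex[OF injB])
      moreover have "ext (0\<^sub>v k) = 0"
      proof
        fix i
        show "ext (0\<^sub>v k) i = 0 i"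
        proof (cases "i \<in> S")
          case True
          then obtain j where j: "j < k" "i = pick S j" using bij by (auto simp: bij_betw_def)
          show ?thesis unfolding j(2) ext_pick[OF j(1)] using j(1) by simp
        qed (simp add: ext_out)
      qed
      moreover have "K.lincomb (u \<circ> ext) B \<in> carrier_vec k"
        by (intro kc K.Ker.lincomb_closed) (use Bk in auto)
      ultimately have "K.lincomb (u \<circ> ext) B = 0\<^sub>v k"
        using inj_onD[OF inj, of "K.lincomb (u \<circ> ext) B" "0\<^sub>v k"] by simp
      then have "K.lin_dep B"
        unfolding K.Ker.lin_dep_def using B(1) b w(2) by (intro exI[of _ B] exI[of _ "u \<circ> ext"] exI[of _ b]) auto
      with ind show False by simp
    qed
  qed
  then show ?thesis
    using K.Ker.dim_basis[OF B] card_image[OF injB] K.kernel_dim unfolding N_def by simp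
qed

lemma nullity_type_dim:
  assumes "M \<in> carrier_mat m n" "S \<subseteq> {..<n}"
  shows "nullity_type M S = real (cfun.dim (null_funs M S))"
proof (cases "S = {}")
  case True
  have "null_funs M {} \<subseteq> {0}" by (auto simp: null_funs_def)
  then have "cfun.dim (null_funs M {}) = 0"
    by (intro cfun.dim_unique[of "{}"]) (auto simp: cfun.independent_empty)
  then show ?thesis using True by (simp add: nullity_type_def)
next
  case False
  then show ?thesis using kernel_dim_null_funs[OF assms] by (simp add: nullity_type_def)
qed

lemma nullity_insert:
  assumes M: "M \<in> carrier_mat m n" and S: "insert i S \<subseteq> {..<n}"
  shows "nullity_type M S \<le> nullity_type M (insert i S)" "nullity_type M (insert i S) \<le> nullity_type M S + 1"
proof -
  have fin: "finite S" using finite_subset[OF S] by simp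
  have "cfun.dim (null_funs M S) \<le> cfun.dim (null_funs M (insert i S)) \<and>
    cfun.dim (null_funs M (insert i S)) \<le> cfun.dim (null_funs M S) + 1"
  proof (cases "i \<in> S")
    case True
    then show ?thesis by (simp add: insert_absorb)
  next
    case False
    then show ?thesis by (simp add: dim_null_funs_insert[OF fin])
  qed
  moreover have "nullity_type M S = cfun.dim (null_funs M S)"
    "nullity_type M (insert i S) = cfun.dim (null_funs M (insert i S))"
    using S by (intro nullity_type_dim[OF M]; blast)+
  ultimately show "nullity_type M S \<le> nullity_type M (insert i S)" "nullity_type M (insert i S) \<le> nullity_type M S + 1"
    by linarith+
qed

lemma nullity_supermodular:
  assumes M: "M \<in> carrier_mat m n" and sub: "insert i (insert j S) \<subseteq> {..<n}" and i: "i \<notin> insert j S"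
  shows "nullity_type M (insert i S) + nullity_type M (insert j S)
    \<le> nullity_type M (insert i (insert j S)) + nullity_type M S"
proof -
  have fin: "finite S" "finite (insert j S)" "i \<notin> S" using finite_subset[OF sub] i by simp_all
  have "null_funs M (insert i S) \<subseteq> null_funs M (insert i (insert j S))"
    by (rule null_funs_mono) blast
  then have "cfun.dim (null_funs M (insert i S)) + cfun.dim (null_funs M (insert j S))
      \<le> cfun.dim (null_funs M (insert i (insert j S))) + cfun.dim (null_funs M S)"
    unfolding dim_null_funs_insert[OF fin(1,3)] dim_null_funs_insert[OF fin(2) i] by auto
  moreover have "nullity_type M T = cfun.dim (null_funs M T)" if "T \<subseteq> insert i (insert j S)" for T
    using that sub by (intro nullity_type_dim[OF M]) blast
  ultimately show ?thesis by (simp add: subset_insertI subset_insertI2 insert_mono flip: of_nat_add)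
qed

section \<open>Ratios and their formal logarithms\<close>

lemma sum_total_exponent:
  assumes "\<forall>(S, \<eta>) \<in> set \<alpha>. S \<in> P" "finite P"
  shows "(\<Sum>S\<in>P. total_exponent \<alpha> S * g S) = (\<Sum>(S, \<eta>)\<leftarrow>\<alpha>. \<eta> * g S)"
  using assms
proof (induction \<alpha>)
  case (Cons a \<alpha>)
  obtain T \<eta> where a: "a = (T, \<eta>)" by force
  have "(\<Sum>S\<in>P. total_exponent (a # \<alpha>) S * g S)
      = (\<Sum>S\<in>P. (if T = S then \<eta> * g S else 0) + total_exponent \<alpha> S * g S)"
    by (intro sum.cong) (auto simp: a total_exponent_def algebra_simps)
  also have "\<dots> = \<eta> * g T + (\<Sum>S\<in>P. total_exponent \<alpha> S * g S)"
    using Cons.prems by (simp add: a sum.distrib)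
  finally show ?case using Cons by (simp add: a)
qed (simp add: total_exponent_def)

text \<open>The entry of the formal logarithm at the empty set only normalises the total sum; it drops out
  against functions that vanish there, such as nullity types and logarithms of minors.\<close>

lemma sum_formal_log:
  assumes r: "r \<in> ratios n" and g: "g {} = 0"
  shows "(\<Sum>S\<in>Pow {..<n}. formal_log n r S * g S)
    = (\<Sum>(S, \<eta>)\<leftarrow>fst r. \<eta> * g S) - (\<Sum>(S, \<eta>)\<leftarrow>snd r. \<eta> * g S)"
proof -
  have sub: "\<forall>(S, \<eta>) \<in> set \<alpha>. S \<in> Pow {..<n}" if "\<alpha> \<in> minor_products n" for \<alpha>
    using that unfolding minor_products_def by fastforce
  have "(\<Sum>S\<in>Pow {..<n}. formal_log n r S * g S)
      = (\<Sum>S\<in>Pow {..<n}. total_exponent (fst r) S * g S) - (\<Sum>S\<in>Pow {..<n}. total_exponent (snd r) S * g S)"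
    unfolding sum_subtractf[symmetric]
    by (intro sum.cong) (auto simp: formal_log_def g algebra_simps)
  also have "\<dots> = (\<Sum>(S, \<eta>)\<leftarrow>fst r. \<eta> * g S) - (\<Sum>(S, \<eta>)\<leftarrow>snd r. \<eta> * g S)"
    by (subst (1 2) sum_total_exponent[OF sub]) (use r in \<open>auto simp: ratios_def\<close>)
  finally show ?thesis .
qed

lemma product_value_ln:
  assumes A: "pos_def n A" and \<alpha>: "\<alpha> \<in> minor_products n"
  shows "0 < product_value \<alpha> A"
    and "ln (product_value \<alpha> A) = (\<Sum>(S, \<eta>)\<leftarrow>\<alpha>. \<eta> * ln (Re (det (submatrix A S S))))"
proof -
  have "0 < product_value \<alpha> A \<and>
    ln (product_value \<alpha> A) = (\<Sum>(S, \<eta>)\<leftarrow>\<alpha>. \<eta> * ln (Re (det (submatrix A S S))))"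
    using \<alpha>
  proof (induction \<alpha>)
    case (Cons a \<alpha>)
    obtain S \<eta> where a: "a = (S, \<eta>)" by force
    have S: "S \<subseteq> {..<n}" and \<alpha>: "\<alpha> \<in> minor_products n"
      using Cons.prems by (auto simp: a minor_products_def)
    have "0 < Re (det (submatrix A S S))" by (rule pos_def_minor[OF A S])
    moreover have "product_value (a # \<alpha>) A = Re (det (submatrix A S S)) powr \<eta> * product_value \<alpha> A"
      by (simp add: a product_value_def)
    ultimately show ?case using Cons.IH[OF \<alpha>] by (simp add: a ln_mult_pos ln_powr)
  qed (simp add: product_value_def)
  then show "0 < product_value \<alpha> A"
    "ln (product_value \<alpha> A) = (\<Sum>(S, \<eta>)\<leftarrow>\<alpha>. \<eta> * ln (Re (det (submatrix A S S))))" by auto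
qed

lemma ratio_value_pos:
  assumes "pos_def n A" "r \<in> ratios n"
  shows "0 < ratio_value r A"
  using assms product_value_ln(1)[OF assms(1)] by (auto simp: ratio_value_def ratios_def)

lemma ln_ratio_value:
  assumes A: "pos_def n A" and r: "r \<in> ratios n"
  shows "ln (ratio_value r A) = (\<Sum>S\<in>Pow {..<n}. formal_log n r S * ln (Re (det (submatrix A S S))))"
proof -
  have *: "fst r \<in> minor_products n" "snd r \<in> minor_products n" using r by (auto simp: ratios_def)
  have "ln (ratio_value r A) = ln (product_value (fst r) A) - ln (product_value (snd r) A)"
    unfolding ratio_value_def using product_value_ln(1)[OF A] * by (intro ln_divide_pos) auto
  then show ?thesis
    using product_value_ln(2)[OF A] * by (simp add: sum_formal_log[OF r] minor_empty)
qed

text \<open>The formal logarithm determines the value, so that boundedness does not depend on the chosen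
  representative of a class.\<close>

lemma same_ratio_value:
  assumes "(r, r') \<in> same_ratio n" "pos_def n A"
  shows "ratio_value r A = ratio_value r' A"
proof -
  have r: "r \<in> ratios n" "r' \<in> ratios n" and
    eq: "\<forall>S \<in> Pow {..<n}. formal_log n r S = formal_log n r' S"
    using assms(1) by (auto simp: same_ratio_def)
  have "ln (ratio_value r A) = ln (ratio_value r' A)"
    unfolding ln_ratio_value[OF assms(2) r(1)] ln_ratio_value[OF assms(2) r(2)]
    using eq by (intro sum.cong) auto
  then show ?thesis using ratio_value_pos[OF assms(2)] r by (metis ln_inj_iff)
qed

section \<open>Bounded ratios satisfy both conditions\<close>

definition real_diag :: "nat \<Rightarrow> (nat \<Rightarrow> real) \<Rightarrow> complex mat" where
  "real_diag n d = mat n n (\<lambda>(i, j). if i = j then complex_of_real (d i) else 0)"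

lemma pos_def_real_diag:
  assumes "\<And>i. i < n \<Longrightarrow> 0 < d i"
  shows "pos_def n (real_diag n d)"
  unfolding pos_def_def
proof (intro conjI ballI impI)
  show carr: "real_diag n d \<in> carrier_mat n n" by (simp add: real_diag_def)
  show "mat_adjoint (real_diag n d) = real_diag n d"
    unfolding hermitian_index[OF carr] by (auto simp: real_diag_def)
  fix v :: "complex vec" assume v: "v \<in> carrier_vec n" and nz: "v \<noteq> 0\<^sub>v n"
  obtain k where k: "k < n" "v $ k \<noteq> 0" using v nz by (metis carrier_vecD eq_vecI index_zero_vec(1,2))
  have "(real_diag n d *\<^sub>v v) \<bullet>c v = (\<Sum>i<n. \<Sum>j<n. real_diag n d $$ (i, j) * v $ j * cnj (v $ i))"
    by (rule quadratic_form_sum[OF carr v])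
  also have "\<dots> = (\<Sum>i<n. \<Sum>j<n. if j = i then complex_of_real (d i) * v $ i * cnj (v $ i) else 0)"
    by (intro sum.cong) (auto simp: real_diag_def)
  also have "\<dots> = complex_of_real (\<Sum>i<n. d i * (cmod (v $ i))\<^sup>2)"
    by (simp add: complex_norm_square[unfolded of_real_power] mult.assoc)
  finally have eq: "(real_diag n d *\<^sub>v v) \<bullet>c v = complex_of_real (\<Sum>i<n. d i * (cmod (v $ i))\<^sup>2)" .
  have "0 < (\<Sum>i<n. d i * (cmod (v $ i))\<^sup>2)"
    using k assms by (intro sum_pos2[of _ k]) (auto simp: less_imp_le)
  then show "0 < (real_diag n d *\<^sub>v v) \<bullet>c v" unfolding eq by (simp add: less_complex_def)
qed

lemma pos_def_diag:
  assumes D: "pos_def n D" "diagonal_mat D"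
  obtains d where "D = real_diag n d" "\<And>i. i < n \<Longrightarrow> 0 < d i"
proof
  have carr: "D \<in> carrier_mat n n" using D(1) by (simp add: pos_def_def)
  have pos: "0 < D $$ (i, i)" if i: "i < n" for i
  proof -
    have "0 < (D *\<^sub>v unit_vec n i) \<bullet>c unit_vec n i"
      using D(1) i unfolding pos_def_def by (metis unit_vec_carrier unit_vec_nonzero)
    also have "(D *\<^sub>v unit_vec n i) \<bullet>c unit_vec n i
        = (\<Sum>k<n. \<Sum>l<n. if l = i then if k = i then D $$ (i, i) else 0 else 0)"
      unfolding quadratic_form_sum[OF carr unit_vec_carrier] using i by (intro sum.cong) auto
    finally show ?thesis using i by simp
  qed
  show "D = real_diag n (\<lambda>i. Re (D $$ (i, i)))"
  proof (rule eq_matI)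
    fix i j assume "i < dim_row (real_diag n (\<lambda>i. Re (D $$ (i, i))))" "j < dim_col (real_diag n (\<lambda>i. Re (D $$ (i, i))))"
    then have ij: "i < n" "j < n" by (auto simp: real_diag_def)
    then show "D $$ (i, j) = real_diag n (\<lambda>i. Re (D $$ (i, i))) $$ (i, j)"
      using pos[OF ij(1)] D(2) carr by (auto simp: real_diag_def diagonal_mat_def less_complex_def complex_eq_iff)
  qed (use carr in \<open>auto simp: real_diag_def\<close>)
  show "0 < Re (D $$ (i, i))" if "i < n" for i using pos[OF that] by (simp add: less_complex_def)
qed

lemma minor_real_diag:
  assumes S: "S \<subseteq> {..<n}"
  shows "Re (det (submatrix (real_diag n d) S S)) = (\<Prod>i\<in>S. d i)"
proof -
  have carr: "real_diag n d \<in> carrier_mat n n" by (simp add: real_diag_def)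
  have fin: "finite S" using S finite_subset by blast
  note bij = bij_betw_pick[OF fin]
  have less: "pick S i < n" if "i < card S" for i using pick_in_set[of i S] that S by auto
  let ?B = "submatrix (real_diag n d) S S"
  have B: "?B \<in> carrier_mat (card S) (card S)" by (rule submatrix_carrier[OF carr S])
  have nth: "?B $$ (i, j) = (if i = j then complex_of_real (d (pick S i)) else 0)" if "i < card S" "j < card S" for i j
  proof -
    have "pick S i = pick S j \<longleftrightarrow> i = j" using bij that by (auto simp: bij_betw_def inj_on_def)
    then show ?thesis unfolding submatrix_nth[OF carr S that]
      using less[OF that(1)] less[OF that(2)] by (simp add: real_diag_def)
  qed
  have "upper_triangular ?B" unfolding upper_triangular_def using B nth by auto
  then have "det ?B = prod_list (diag_mat ?B)" by (rule det_upper_triangular[OF _ B])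
  also have "\<dots> = (\<Prod>i<card S. complex_of_real (d (pick S i)))"
    using B nth by (auto simp: prod_list_diag_prod atLeast0LessThan intro!: prod.cong)
  also have "\<dots> = complex_of_real (\<Prod>i\<in>S. d i)"
    by (simp add: prod.reindex_bij_betw[OF bij, symmetric])
  finally show ?thesis by (simp only: Re_complex_of_real)
qed

text \<open>Along the curve of diagonal matrices with entries \<open>d\<^sub>i powr s\<close> the logarithm of the ratio is linear in
  \<open>s\<close>; a linear function bounded above on the whole line is zero.\<close>

lemma bounded_imp_homogeneous:
  assumes r: "r \<in> ratios n" and bdd: "bounded_ratio n r"
  shows "homogeneous n r"
  unfolding homogeneous_def
proof (intro allI impI)
  fix D assume "pos_def n D \<and> diagonal_mat D"
  then obtain d where D: "D = real_diag n d" "\<And>i. i < n \<Longrightarrow> 0 < d i"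
    using pos_def_diag by metis
  obtain C where C: "\<And>A. pos_def n A \<Longrightarrow> ratio_value r A \<le> C"
    using bdd by (auto simp: bounded_ratio_def)
  define E where "E s = real_diag n (\<lambda>i. d i powr s)" for s
  have PD: "pos_def n (E s)" for s
    unfolding E_def using D(2) by (intro pos_def_real_diag) (simp add: less_imp_neq[symmetric])
  have PD1: "pos_def n (real_diag n d)" using D(2) by (rule pos_def_real_diag)
  have minor: "ln (Re (det (submatrix (E s) S S))) = s * ln (Re (det (submatrix (real_diag n d) S S)))"
    if "S \<subseteq> {..<n}" for S s
    unfolding E_def minor_real_diag[OF that] by (simp flip: prod_powr_distrib)
  define c where "c = ln (ratio_value r (real_diag n d))"
  have "s * c \<le> ln C" for s
  proof -
    have "s * c = ln (ratio_value r (E s))"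
      unfolding c_def ln_ratio_value[OF PD r] ln_ratio_value[OF PD1 r]
      by (simp add: sum_distrib_left minor mult.left_commute)
    also have "\<dots> \<le> ln C"
      using C[OF PD] ratio_value_pos[OF PD r] by (simp add: ln_mono order_less_le_trans)
    finally show ?thesis .
  qed
  \<comment> \<open>for nonzero \<open>c\<close> this \<open>s\<close> would give \<open>ln C + 1 \<le> ln C\<close>\<close>
  from this[of "(ln C + 1) / c"] have "c = 0" by (cases "c = 0") auto
  then show "ratio_value r D = 1"
    using ratio_value_pos[OF PD1 r] by (simp add: c_def D(1) ln_eq_zero_iff)
qed

lemma submatrix_gram_shift:
  fixes M :: "complex mat"
  assumes M: "M \<in> carrier_mat m n" and S: "S \<subseteq> {..<n}"
  shows "submatrix (gram_shift n M t) S S = gram_shift (card S) (submatrix M UNIV S) t"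
proof (rule eq_matI)
  note G = mat_adjoint_gram[OF M] and N = submatrix_cols[OF M S]
  note GN = mat_adjoint_gram[OF N(1)]
  have carr: "gram_shift n M t \<in> carrier_mat n n" using G by (simp add: gram_shift_def)
  have carrN: "gram_shift (card S) (submatrix M UNIV S) t \<in> carrier_mat (card S) (card S)"
    using GN by (simp add: gram_shift_def)
  have sub: "submatrix (gram_shift n M t) S S \<in> carrier_mat (card S) (card S)"
    by (rule submatrix_carrier[OF carr S])
  have fin: "finite S" using S finite_subset by blast
  note bij = bij_betw_pick[OF fin]
  show "dim_row (submatrix (gram_shift n M t) S S) = dim_row (gram_shift (card S) (submatrix M UNIV S) t)"
    "dim_col (submatrix (gram_shift n M t) S S) = dim_col (gram_shift (card S) (submatrix M UNIV S) t)"
    using carrier_matD[OF sub] carrier_matD[OF carrN] by simp_all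
  fix i j assume "i < dim_row (gram_shift (card S) (submatrix M UNIV S) t)" "j < dim_col (gram_shift (card S) (submatrix M UNIV S) t)"
  then have ij: "i < card S" "j < card S" using carrier_matD[OF carrN] by simp_all
  have less: "pick S k < n" if "k < card S" for k using pick_in_set[of k S] that S by auto
  have pick_eq: "pick S i = pick S j \<longleftrightarrow> i = j" using bij ij by (auto simp: bij_betw_def inj_on_def)
  have "(\<Sum>k<m. cnj (M $$ (k, pick S i)) * M $$ (k, pick S j))
      = (\<Sum>k<m. cnj (submatrix M UNIV S $$ (k, i)) * submatrix M UNIV S $$ (k, j))"
    using ij by (intro sum.cong) (simp_all add: N(2))
  then show "submatrix (gram_shift n M t) S S $$ (i, j) = gram_shift (card S) (submatrix M UNIV S) t $$ (i, j)"
    unfolding submatrix_nth[OF carr S ij] unfolding gram_shift_def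
    using less[OF ij(1)] less[OF ij(2)] ij pick_eq carrier_matD[OF G] carrier_matD[OF GN]
    by (simp add: gram_index[OF M] gram_index[OF N(1)] del: index_mult_mat(1))
qed

text \<open>Each principal minor of \<open>M\<^sup>* M + t I\<close> is the determinant of a matrix of the same shape, built from
  the columns \<open>S\<close> of \<open>M\<close>.  Division by \<open>ln t < 0\<close> turns the upper bound \<open>ln C\<close> into a lower bound that tends
  to 0.\<close>

lemma bounded_imp_nullity_nonneg:
  assumes r: "r \<in> ratios n" and bdd: "bounded_ratio n r"
  shows "nullity_nonneg n r"
  unfolding nullity_nonneg_def
proof (intro allI ballI)
  fix m and M :: "complex mat" assume M: "M \<in> carrier_mat m n"
  obtain C where C: "\<And>A. pos_def n A \<Longrightarrow> ratio_value r A \<le> C"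
    using bdd by (auto simp: bounded_ratio_def)
  define A where "A = gram_shift n M"
  have PD: "pos_def n (A t)" if "0 < t" for t
    unfolding A_def using that by (intro pos_def_gram_shift[OF M]) auto
  define g where "g t S = ln (Re (det (submatrix (A t) S S))) / ln t" for t S
  have lim: "((\<lambda>t. g t S) \<longlongrightarrow> nullity_type M S) (at_right 0)" if S: "S \<subseteq> {..<n}" for S
  proof (cases "S = {}")
    case True
    then show ?thesis by (simp add: g_def minor_empty nullity_type_def)
  next
    case False
    then show ?thesis
      using ln_det_gram_shift[OF submatrix_cols(1)[OF M S]]
      by (simp add: g_def A_def submatrix_gram_shift[OF M S] nullity_type_def)
  qed
  have "((\<lambda>t. \<Sum>S\<in>Pow {..<n}. formal_log n r S * g t S) \<longlongrightarrow>
      (\<Sum>S\<in>Pow {..<n}. formal_log n r S * nullity_type M S)) (at_right 0)"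
    by (intro tendsto_intros lim) auto
  moreover have "((\<lambda>t. ln C / ln t) \<longlongrightarrow> 0) (at_right (0::real))"
    using tendsto_divide_0[OF tendsto_const filterlim_mono[OF ln_at_0 at_bot_le_at_infinity order_refl]] .
  moreover have ev01: "\<forall>\<^sub>F t in at_right (0::real). t \<in> {0<..<1}"
    by (rule eventually_at_right_real) simp
  have "\<forall>\<^sub>F t in at_right 0. ln C / ln t \<le> (\<Sum>S\<in>Pow {..<n}. formal_log n r S * g t S)"
    using ev01
  proof eventually_elim
    case (elim t)
    then have t: "0 < t" "ln t < 0" by auto
    have "ln (ratio_value r (A t)) \<le> ln C"
      using C[OF PD[OF t(1)]] ratio_value_pos[OF PD[OF t(1)] r] by (simp add: ln_mono order_less_le_trans)
    then have "ln C / ln t \<le> ln (ratio_value r (A t)) / ln t"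
      using t(2) by (simp add: divide_right_mono_neg)
    also have "\<dots> = (\<Sum>S\<in>Pow {..<n}. formal_log n r S * g t S)"
      unfolding ln_ratio_value[OF PD[OF t(1)] r] g_def by (simp add: sum_divide_distrib)
    finally show ?case .
  qed
  ultimately show "0 \<le> (\<Sum>S\<in>Pow {..<n}. formal_log n r S * nullity_type M S)"
    using tendsto_le[OF trivial_limit_at_right_real] by blast
qed

lemma bounded_ratios_subset: "bounded_ratios n \<subseteq> nullity_ratios n"
  unfolding bounded_ratios_def nullity_ratios_def quotient_def
  using bounded_imp_homogeneous bounded_imp_nullity_nonneg by blast

text \<open>Passing to classes: if the class of \<open>r\<close> contained a bounded ratio, then \<open>r\<close> itself would be bounded,
  having the same values.\<close>

lemma bounded_ratios_psubset:
  assumes r: "r \<in> ratios n" "homogeneous n r" "nullity_nonneg n r" and unb: "\<not> bounded_ratio n r"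
  shows "bounded_ratios n \<subset> nullity_ratios n"
proof (rule psubsetI)
  show "bounded_ratios n \<subseteq> nullity_ratios n" by (rule bounded_ratios_subset)
  have refl: "(s, s) \<in> same_ratio n" if "s \<in> ratios n" for s using that by (simp add: same_ratio_def)
  have "same_ratio n `` {r} \<in> nullity_ratios n"
    unfolding nullity_ratios_def using r by (intro quotientI) simp
  moreover have "same_ratio n `` {r} \<notin> bounded_ratios n"
  proof
    assume "same_ratio n `` {r} \<in> bounded_ratios n"
    then obtain s where s: "s \<in> ratios n" "bounded_ratio n s" "same_ratio n `` {r} = same_ratio n `` {s}"
      unfolding bounded_ratios_def by (auto elim!: quotientE)
    then have "(s, r) \<in> same_ratio n" using refl[OF r(1)] by blast
    then have "bounded_ratio n r" using s(2) same_ratio_value unfolding bounded_ratio_def by metis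
    with unb show False ..
  qed
  ultimately show "bounded_ratios n \<noteq> nullity_ratios n" by blast
qed

section \<open>Evaluating explicit principal minors\<close>

text \<open>A determinant indexed by lists of row and column labels: it avoids the renumbering by \<open>pick\<close> and
  can be evaluated by rewriting.\<close>

fun laplace_det :: "('b \<Rightarrow> 'b \<Rightarrow> 'a :: comm_ring_1) \<Rightarrow> 'b list \<Rightarrow> 'b list \<Rightarrow> 'a" where
  "laplace_det f [] ys = 1"
| "laplace_det f (x # xs) ys =
    (\<Sum>j<length ys. (-1) ^ j * f x (ys ! j) * laplace_det f xs (take j ys @ drop (Suc j) ys))"

lemma det_laplace:
  assumes "length xs = length ys"
  shows "det (mat (length xs) (length xs) (\<lambda>(i, j). f (xs ! i) (ys ! j))) = laplace_det f xs ys"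
  using assms
proof (induction xs arbitrary: ys)
  case Nil
  then show ?case by (simp add: det_dim_zero)
next
  case (Cons x xs)
  let ?k = "length xs"
  let ?A = "mat (Suc ?k) (Suc ?k) (\<lambda>(i, j). f ((x # xs) ! i) (ys ! j))"
  have A: "?A \<in> carrier_mat (Suc ?k) (Suc ?k)" by simp
  have del: "mat_delete ?A 0 j = mat ?k ?k (\<lambda>(i, l). f (xs ! i) ((take j ys @ drop (Suc j) ys) ! l))"
    if "j < Suc ?k" for j
    using that Cons.prems by (intro eq_matI) (auto simp: mat_delete_def nth_append min_def)
  have IH: "det (mat ?k ?k (\<lambda>(i, l). f (xs ! i) ((take j ys @ drop (Suc j) ys) ! l)))
      = laplace_det f xs (take j ys @ drop (Suc j) ys)" if "j < Suc ?k" for j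
    by (rule Cons.IH) (use that Cons.prems in auto)
  have "det ?A = (\<Sum>j<Suc ?k. ?A $$ (0, j) * cofactor ?A 0 j)"
    by (rule laplace_expansion_row[OF A]) simp
  also have "\<dots> = (\<Sum>j<Suc ?k. (-1) ^ j * f x (ys ! j) * laplace_det f xs (take j ys @ drop (Suc j) ys))"
    by (rule sum.cong) (auto simp: cofactor_def del IH simp del: mat_delete_index)
  finally show ?case using Cons.prems by (simp only: laplace_det.simps length_Cons)
qed

lemma laplace_det_3:
  "laplace_det f [a, b, c] [p, q, r] = f a p * (f b q * f c r - f b r * f c q)
    - f a q * (f b p * f c r - f b r * f c p) + f a r * (f b p * f c q - f b q * f c p)"
  by (simp add: numeral_2_eq_2 algebra_simps)

lemma laplace_det_of_real:
  "laplace_det (\<lambda>i j. complex_of_real (f i j)) xs ys = complex_of_real (laplace_det f xs ys)"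
  by (induction xs arbitrary: ys) simp_all

lemma pick_sorted_list:
  assumes "sorted_wrt (<) xs" "i < length xs"
  shows "pick (set xs) i = xs ! i"
proof -
  have "{a \<in> set xs. a < xs ! i} = (!) xs ` {..<i}"
  proof (intro equalityI subsetI)
    fix a assume "a \<in> {a \<in> set xs. a < xs ! i}"
    then obtain j where j: "j < length xs" "a = xs ! j" "xs ! j < xs ! i" by (auto simp: in_set_conv_nth)
    have "j < i"
    proof (rule ccontr)
      assume "\<not> j < i"
      then have "xs ! i \<le> xs ! j"
        using sorted_wrt_nth_less[OF assms(1), of i j] j(1) by (cases "i = j") auto
      with j(3) show False by simp
    qed
    with j(2) show "a \<in> (!) xs ` {..<i}" by blast
  next
    fix a assume "a \<in> (!) xs ` {..<i}"
    then show "a \<in> {a \<in> set xs. a < xs ! i}"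
      using sorted_wrt_nth_less[OF assms(1)] assms(2) by force
  qed
  moreover have "inj_on ((!) xs) {..<i}"
    using assms by (auto simp: inj_on_def nth_eq_iff_index_eq strict_sorted_iff)
  ultimately have "card {a \<in> set xs. a < xs ! i} = i" by (simp add: card_image)
  then show ?thesis using pick_card_in_set[of "xs ! i" "set xs"] assms(2) by simp
qed

lemma real_minor_laplace:
  assumes A: "A \<in> carrier_mat n n" and sorted: "sorted_wrt (<) xs" and S: "set xs \<subseteq> {..<n}"
    and entries: "\<And>i j. i \<in> set xs \<Longrightarrow> j \<in> set xs \<Longrightarrow> A $$ (i, j) = complex_of_real (f i j)"
  shows "Re (det (submatrix A (set xs) (set xs))) = laplace_det f xs xs"
proof -
  have card: "card (set xs) = length xs" using sorted by (simp add: distinct_card strict_sorted_iff)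
  have "submatrix A (set xs) (set xs)
      = mat (length xs) (length xs) (\<lambda>(i, j). complex_of_real (f (xs ! i) (xs ! j)))"
  proof (rule eq_matI)
    fix i j assume "i < dim_row (mat (length xs) (length xs) (\<lambda>(i, j). complex_of_real (f (xs ! i) (xs ! j))))"
      "j < dim_col (mat (length xs) (length xs) (\<lambda>(i, j). complex_of_real (f (xs ! i) (xs ! j))))"
    then have ij: "i < length xs" "j < length xs" by simp_all
    show "submatrix A (set xs) (set xs) $$ (i, j)
        = mat (length xs) (length xs) (\<lambda>(i, j). complex_of_real (f (xs ! i) (xs ! j))) $$ (i, j)"
      using ij entries by (simp add: submatrix_nth[OF A S] card pick_sorted_list[OF sorted])
  qed (use carrier_matD[OF submatrix_carrier[OF A S]] card in simp_all)
  then show ?thesis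
    using det_laplace[of xs xs "\<lambda>i j. complex_of_real (f i j)", OF refl]
    by (simp only: laplace_det_of_real Re_complex_of_real)
qed

section \<open>A nullity-nonnegative ratio that is unbounded\<close>

text \<open>Each of the five elements occurs three times in the numerator and three times in the denominator,
  which makes the ratio homogeneous.\<close>

definition witness :: ratio where
  "witness =
    ([({0, 1}, 1), ({2}, 1), ({0, 3}, 1), ({1, 2, 4}, 1), ({3, 4}, 1), ({0, 1, 2, 3, 4}, 1)],
     [({0, 2}, 1), ({1, 2}, 1), ({3}, 1), ({0, 1, 3}, 1), ({4}, 1), ({0, 1, 4}, 1), ({2, 3, 4}, 1)])"

lemma witness_ratio: "5 \<le> n \<Longrightarrow> witness \<in> ratios n"
  by (auto simp: witness_def ratios_def minor_products_def)

lemma witness_homogeneous: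
  assumes n: "5 \<le> n"
  shows "homogeneous n witness"
  unfolding homogeneous_def
proof (intro allI impI)
  fix D assume "pos_def n D \<and> diagonal_mat D"
  then obtain d where D: "D = real_diag n d" "\<And>i. i < n \<Longrightarrow> 0 < d i"
    using pos_def_diag by metis
  have d: "0 < d 0" "0 < d 1" "0 < d 2" "0 < d 3" "0 < d 4" using D(2) n by auto
  have minor: "Re (det (submatrix D S S)) = (\<Prod>i\<in>S. d i)" if "S \<subseteq> {0, 1, 2, 3, 4}" for S
    unfolding D(1) using that n by (intro minor_real_diag) auto
  show "ratio_value witness D = 1"
    using d by (simp add: ratio_value_def product_value_def witness_def minor)
qed

text \<open>Adding the thirteen inequalities below, the one for \<open>{0, 1, 2, 3, 4}\<close> taken twice, gives
  \<open>- 1 \<le> 2 * gap\<close>.  The \<open>- 1\<close> is due to the bound on the increment of the nullity from \<open>{1, 2, 4}\<close> to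
  \<open>{0, 1, 2, 4}\<close>, and integrality of \<open>gap\<close> removes it.\<close>

lemma witness_nullity_nonneg:
  assumes n: "5 \<le> n"
  shows "nullity_nonneg n witness"
  unfolding nullity_nonneg_def
proof (intro allI ballI)
  fix m and M :: "complex mat" assume M: "M \<in> carrier_mat m n"
  define v where "v = nullity_type M"
  define gap where "gap = v {0, 1} + v {2} + v {0, 3} + v {1, 2, 4} + v {3, 4} + v {0, 1, 2, 3, 4}
    - (v {0, 2} + v {1, 2} + v {3} + v {0, 1, 3} + v {4} + v {0, 1, 4} + v {2, 3, 4})"
  have super: "v (insert i S) + v (insert j S) \<le> v (insert i (insert j S)) + v S"
    if "insert i (insert j S) \<subseteq> {0, 1, 2, 3, 4}" "i \<notin> insert j S" for i j S
    unfolding v_def using that n by (intro nullity_supermodular[OF M]) auto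
  have unit: "v S \<le> v (insert i S)" "v (insert i S) \<le> v S + 1" if "insert i S \<subseteq> {0, 1, 2, 3, 4}" for i S
    unfolding v_def using that n by (intro nullity_insert[OF M]; auto)+
  have "v {0, 1, 4} + v {0, 1, 2} \<le> v {0, 1, 2, 4} + v {0, 1}"
    using super[of 2 4 "{0, 1}"] by (simp add: insert_commute)
  moreover have "v {0, 2} + v {1, 2} \<le> v {0, 1, 2} + v {2}"
    using super[of 0 1 "{2}"] by (simp add: insert_commute)
  moreover have "v {1, 2} + v {2, 4} \<le> v {1, 2, 4} + v {2}"
    using super[of 1 4 "{2}"] by (simp add: insert_commute)
  moreover have "v {4} \<le> v {0, 4}"
    using unit(1)[of 0 "{4}"] by (simp add: insert_commute)
  moreover have "v {0} + v {3} \<le> v {0, 3}"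
    using super[of 0 3 "{}"] by (simp add: insert_commute v_def nullity_type_def)
  moreover have "v {3} + v {4} \<le> v {3, 4}"
    using super[of 3 4 "{}"] by (simp add: insert_commute v_def nullity_type_def)
  moreover have "v {0, 1, 2, 4} \<le> v {1, 2, 4} + 1"
    using unit(2)[of 0 "{1, 2, 4}"] by (simp add: insert_commute)
  moreover have "v {0, 2, 3, 4} + v {0, 1, 3, 4} \<le> v {0, 1, 2, 3, 4} + v {0, 3, 4}"
    using super[of 1 2 "{0, 3, 4}"] by (simp add: insert_commute)
  moreover have "v {0, 1, 3} + v {0, 3, 4} \<le> v {0, 1, 3, 4} + v {0, 3}"
    using super[of 1 4 "{0, 3}"] by (simp add: insert_commute)
  moreover have "v {0, 1, 3} + v {0, 1, 4} \<le> v {0, 1, 3, 4} + v {0, 1}"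
    using super[of 3 4 "{0, 1}"] by (simp add: insert_commute)
  moreover have "v {0, 3, 4} + v {2, 3, 4} \<le> v {0, 2, 3, 4} + v {3, 4}"
    using super[of 0 2 "{3, 4}"] by (simp add: insert_commute)
  moreover have "v {0, 2} + v {0, 4} \<le> v {0, 2, 4} + v {0}"
    using super[of 2 4 "{0}"] by (simp add: insert_commute)
  moreover have "v {2, 3, 4} + v {0, 2, 4} \<le> v {0, 2, 3, 4} + v {2, 4}"
    using super[of 0 3 "{2, 4}"] by (simp add: insert_commute)
  ultimately have "- 1 \<le> 2 * gap" unfolding gap_def by argo
  moreover have "gap \<in> \<int>"
    unfolding gap_def v_def nullity_type_def by (auto intro!: Ints_add Ints_diff)
  ultimately have "0 \<le> gap" by (auto elim!: Ints_cases)
  moreover have "(\<Sum>S\<in>Pow {..<n}. formal_log n witness S * nullity_type M S) = gap"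
    by (subst sum_formal_log[OF witness_ratio[OF n]])
      (simp_all add: nullity_type_def[of M "{}"] witness_def gap_def v_def)
  ultimately show "0 \<le> (\<Sum>S\<in>Pow {..<n}. formal_log n witness S * nullity_type M S)" by simp
qed

text \<open>The columns are the vectors \<open>e\<^sub>0\<close>, \<open>e\<^sub>1 - x e\<^sub>0\<close>, \<open>e\<^sub>2 - x e\<^sub>0\<close>, \<open>e\<^sub>3 - x e\<^sub>1\<close>,
  \<open>e\<^sub>4 - x e\<^sub>0 - x e\<^sub>1\<close>, followed by unit vectors.  As \<open>x\<close> grows, the columns
  1 and 2 turn towards the line of \<open>e\<^sub>0\<close>, column 3 towards that of \<open>e\<^sub>1\<close>, and column 4 towards that of
  \<open>e\<^sub>0 + e\<^sub>1\<close>.\<close>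

definition spread_mat :: "nat \<Rightarrow> real \<Rightarrow> complex mat" where
  "spread_mat n x = mat n n (\<lambda>(k, j). complex_of_real
    (if k = j then 1 else if (k, j) \<in> {(0, 1), (0, 2), (1, 3), (0, 4), (1, 4)} then - x else 0))"

lemma spread_mat_carrier: "spread_mat n x \<in> carrier_mat n n"
  by (simp add: spread_mat_def)

lemma det_spread: "det (spread_mat n x) = 1"
proof -
  have "upper_triangular (spread_mat n x)"
    unfolding upper_triangular_def by (auto simp: spread_mat_def)
  then have "det (spread_mat n x) = prod_list (diag_mat (spread_mat n x))"
    by (rule det_upper_triangular[OF _ spread_mat_carrier])
  also have "\<dots> = 1" by (simp add: prod_list_diag_prod spread_mat_def)
  finally show ?thesis .
qed

lemma pos_def_spread: "pos_def n (gram_shift n (spread_mat n x) 0)"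
proof (rule pos_def_gram_shift[OF spread_mat_carrier order_refl])
  note U = spread_mat_carrier[of n x]
  have triv: "v = 0\<^sub>v n" if "v \<in> carrier_vec n" "spread_mat n x *\<^sub>v v = 0\<^sub>v n" for v
    using det_0_iff_vec_prod_zero_field[OF U] det_spread that by (metis one_neq_zero)
  show "mat_kernel (spread_mat n x) \<subseteq> {0\<^sub>v n}"
  proof
    fix v assume "v \<in> mat_kernel (spread_mat n x)"
    from mat_kernelD[OF U this] triv show "v \<in> {0\<^sub>v n}" by blast
  qed
qed

lemma det_spread_gram: "det (gram_shift n (spread_mat n x) 0) = 1"
proof -
  note U = spread_mat_carrier[of n x]
  have zero: "gram_shift n (spread_mat n x) 0 = mat_adjoint (spread_mat n x) * spread_mat n x"
    using carrier_matD[OF mat_adjoint_gram[OF U]]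
    by (intro eq_matI) (simp_all add: gram_shift_def del: index_mult_mat)
  have adj: "mat_adjoint (spread_mat n x) = transpose_mat (spread_mat n x)"
  proof (rule eq_matI)
    fix i j assume "i < dim_row (transpose_mat (spread_mat n x))" "j < dim_col (transpose_mat (spread_mat n x))"
    then have "i < n" "j < n" using U by auto
    then show "mat_adjoint (spread_mat n x) $$ (i, j) = transpose_mat (spread_mat n x) $$ (i, j)"
      by (subst index_mat_adjoint[OF U]) (auto simp: spread_mat_def)
  qed (use carrier_matD[OF mat_adjoint_carrier[OF U]] carrier_matD[OF U] in simp_all)
  show ?thesis unfolding zero adj
    using U by (subst det_mult[of _ n]) (auto simp: det_transpose det_spread)
qed

text \<open>The first five rows and columns of the Gram matrix of the columns of \<open>spread_mat n x\<close>.\<close>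

definition spread_gram :: "real \<Rightarrow> nat \<Rightarrow> nat \<Rightarrow> real" where
  "spread_gram x i j =
    [[1, - x, - x, 0, - x],
     [- x, x\<^sup>2 + 1, x\<^sup>2, - x, x\<^sup>2 - x],
     [- x, x\<^sup>2, x\<^sup>2 + 1, 0, x\<^sup>2],
     [0, - x, 0, x\<^sup>2 + 1, x\<^sup>2],
     [- x, x\<^sup>2 - x, x\<^sup>2, x\<^sup>2, 2 * x\<^sup>2 + 1]] ! i ! j"

lemma spread_gram_index:
  assumes n: "5 \<le> n" and ij: "i < 5" "j < 5"
  shows "gram_shift n (spread_mat n x) 0 $$ (i, j) = complex_of_real (spread_gram x i j)"
proof -
  note G = mat_adjoint_gram[OF spread_mat_carrier[of n x]]
  let ?u = "\<lambda>k j. if k = j then 1 else if (k, j) \<in> {(0::nat, 1::nat), (0, 2), (1, 3), (0, 4), (1, 4)} then - x else 0"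
  have "gram_shift n (spread_mat n x) 0 $$ (i, j) = (mat_adjoint (spread_mat n x) * spread_mat n x) $$ (i, j)"
    using n ij carrier_matD[OF G] by (simp add: gram_shift_def del: index_mult_mat(1))
  also have "\<dots> = (\<Sum>k<n. cnj (spread_mat n x $$ (k, i)) * spread_mat n x $$ (k, j))"
    using n ij by (intro gram_index[OF spread_mat_carrier]) auto
  also have "\<dots> = (\<Sum>k<n. complex_of_real (?u k i * ?u k j))"
    using n ij by (intro sum.cong) (auto simp: spread_mat_def)
  also have "\<dots> = (\<Sum>k<5. complex_of_real (?u k i * ?u k j))"
    using n ij by (intro sum.mono_neutral_right) auto
  also have "\<dots> = complex_of_real (\<Sum>k<5. ?u k i * ?u k j)" by simp
  also have "(\<Sum>k<5. ?u k i * ?u k j) = spread_gram x i j"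
  proof -
    have "i \<in> {0, 1, 2, 3, 4}" "j \<in> {0, 1, 2, 3, 4}" using ij by auto
    moreover have "(\<Sum>k<5. g k) = g 0 + g 1 + g 2 + g 3 + g 4" for g :: "nat \<Rightarrow> real"
      by (simp add: eval_nat_numeral)
    ultimately show ?thesis
      unfolding spread_gram_def by (elim insertE emptyE) (simp_all add: power2_eq_square)
  qed
  finally show ?thesis .
qed

lemma spread_minors:
  fixes n :: nat and x :: real
  assumes n: "5 \<le> n"
  defines "m \<equiv> \<lambda>S. Re (det (submatrix (gram_shift n (spread_mat n x) 0) S S))"
  shows "m {0, 1} = 1" "m {2} = x\<^sup>2 + 1" "m {0, 3} = x\<^sup>2 + 1"
    "m {1, 2, 4} = (x\<^sup>2 + x)\<^sup>2 + 2 * x\<^sup>2 + 1" "m {3, 4} = x ^ 4 + 3 * x\<^sup>2 + 1"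
    "m {0, 1, 2, 3, 4} = 1"
    "m {0, 2} = 1" "m {1, 2} = 2 * x\<^sup>2 + 1" "m {3} = x\<^sup>2 + 1" "m {0, 1, 3} = 1"
    "m {4} = 2 * x\<^sup>2 + 1" "m {0, 1, 4} = 1" "m {2, 3, 4} = (x\<^sup>2 + 1) * (3 * x\<^sup>2 + 1)"
proof -
  have carr: "gram_shift n (spread_mat n x) 0 \<in> carrier_mat n n"
    using pos_def_spread by (simp add: pos_def_def)
  have m: "m (set xs) = laplace_det (spread_gram x) xs xs"
    if "sorted_wrt (<) xs" "set xs \<subseteq> {..<5}" for xs
    unfolding m_def using that n
    by (intro real_minor_laplace[OF carr] spread_gram_index) auto
  note simps = spread_gram_def power2_eq_square power4_eq_xxxx algebra_simps
  show "m {0, 1} = 1" using m[of "[0, 1]"] by (simp add: simps)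
  show "m {2} = x\<^sup>2 + 1" using m[of "[2]"] by (simp add: simps)
  show "m {0, 3} = x\<^sup>2 + 1" using m[of "[0, 3]"] by (simp add: simps)
  show "m {1, 2, 4} = (x\<^sup>2 + x)\<^sup>2 + 2 * x\<^sup>2 + 1" 
    using m[of "[1, 2, 4]"] unfolding laplace_det_3 by (simp add: simps)
  show "m {3, 4} = x ^ 4 + 3 * x\<^sup>2 + 1" using m[of "[3, 4]"] by (simp add: simps)
  \<comment> \<open>the full minor comes from the triangular factorisation; the expansion would have 120 terms\<close>
  show "m {0, 1, 2, 3, 4} = 1"
  proof -
    have "submatrix (gram_shift n (spread_mat n x) 0) {..<5} {..<5} = gram_shift 5 (spread_mat 5 x) 0"
    proof (rule eq_matI)
      have S: "{..<5} \<subseteq> {..<n}" using n by auto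
      have carr5: "gram_shift 5 (spread_mat 5 x) 0 \<in> carrier_mat 5 5"
        using pos_def_spread by (simp add: pos_def_def)
      show "dim_row (submatrix (gram_shift n (spread_mat n x) 0) {..<5} {..<5}) = dim_row (gram_shift 5 (spread_mat 5 x) 0)"
        "dim_col (submatrix (gram_shift n (spread_mat n x) 0) {..<5} {..<5}) = dim_col (gram_shift 5 (spread_mat 5 x) 0)"
        using carrier_matD[OF submatrix_carrier[OF carr S]] carrier_matD[OF carr5] by simp_all
      fix i j assume "i < dim_row (gram_shift 5 (spread_mat 5 x) 0)" "j < dim_col (gram_shift 5 (spread_mat 5 x) 0)"
      then have ij: "i < 5" "j < 5" using carrier_matD[OF carr5] by simp_all
      have pick: "pick {..<5} k = k" if "k < 5" for k
        using pick_sorted_list[of "[0..<5]" k] that by (simp add: atLeast0LessThan)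
      show "submatrix (gram_shift n (spread_mat n x) 0) {..<5} {..<5} $$ (i, j) = gram_shift 5 (spread_mat 5 x) 0 $$ (i, j)"
        using ij by (simp add: submatrix_nth[OF carr S] pick spread_gram_index n)
    qed
    moreover have "{0, 1, 2, 3, 4} = {..<5::nat}" by auto
    ultimately show ?thesis unfolding m_def by (simp only: det_spread_gram one_complex.sel)
  qed
  show "m {0, 2} = 1" using m[of "[0, 2]"] by (simp add: simps)
  show "m {1, 2} = 2 * x\<^sup>2 + 1" using m[of "[1, 2]"] by (simp add: simps)
  show "m {3} = x\<^sup>2 + 1" using m[of "[3]"] by (simp add: simps)
  show "m {0, 1, 3} = 1" 
    using m[of "[0, 1, 3]"] unfolding laplace_det_3 by (simp add: simps)
  show "m {4} = 2 * x\<^sup>2 + 1" using m[of "[4]"] by (simp add: simps)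
  show "m {0, 1, 4} = 1" 
    using m[of "[0, 1, 4]"] unfolding laplace_det_3 by (simp add: simps)
  show "m {2, 3, 4} = (x\<^sup>2 + 1) * (3 * x\<^sup>2 + 1)" 
    using m[of "[2, 3, 4]"] unfolding laplace_det_3 by (simp add: simps)
qed

lemma witness_growth:
  assumes n: "5 \<le> n" and x: "1 \<le> x"
  shows "x\<^sup>2 / 36 \<le> ratio_value witness (gram_shift n (spread_mat n x) 0)"
proof -
  define y where "y = x\<^sup>2"
  have y: "1 \<le> y" using x by (simp add: y_def)
  have x4: "x ^ 4 = y\<^sup>2" by (simp add: y_def flip: power_mult)
  define a where "a = (y + x)\<^sup>2 + 2 * y + 1"
  define b where "b = y\<^sup>2 + 3 * y + 1"
  have "y\<^sup>2 \<le> (y + x)\<^sup>2" using x y by (intro power_mono) auto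
  then have ab: "y\<^sup>2 \<le> a" "y\<^sup>2 \<le> b" using y by (auto simp: a_def b_def)
  then have pos: "0 < a" "0 < b" using y by (auto intro: less_le_trans[rotated])
  have "ratio_value witness (gram_shift n (spread_mat n x) 0)
      = ((y + 1) * ((y + 1) * (a * b))) / ((2 * y + 1) * ((y + 1) * ((2 * y + 1) * ((y + 1) * (3 * y + 1)))))"
    using y pos unfolding ratio_value_def product_value_def witness_def
    by (simp add: spread_minors[OF n] x4 a_def b_def del: One_nat_def flip: y_def)
  also have "\<dots> = ((y + 1) * (y + 1) * (a * b)) / ((y + 1) * (y + 1) * ((2 * y + 1) * (2 * y + 1) * (3 * y + 1)))"
    by (simp only: mult_ac)
  also have "\<dots> = (a * b) / ((2 * y + 1) * (2 * y + 1) * (3 * y + 1))"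
    using y by (intro mult_divide_mult_cancel_left) simp
  also have "\<dots> \<ge> (y\<^sup>2 * y\<^sup>2) / ((3 * y) * (3 * y) * (4 * y))"
    using y ab pos by (intro frac_le mult_mono) auto
  also have "(y\<^sup>2 * y\<^sup>2) / ((3 * y) * (3 * y) * (4 * y)) = y / 36"
    using y by (simp add: field_simps power2_eq_square)
  finally show ?thesis by (simp add: y_def)
qed

lemma witness_unbounded:
  assumes n: "5 \<le> n"
  shows "\<not> bounded_ratio n witness"
proof
  assume "bounded_ratio n witness"
  then obtain C where C: "\<And>A. pos_def n A \<Longrightarrow> ratio_value witness A \<le> C"
    by (auto simp: bounded_ratio_def)
  define x where "x = 36 * \<bar>C\<bar> + 1"
  have x: "1 \<le> x" by (simp add: x_def)
  have "C < x / 36" by (simp add: x_def)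
  also have "\<dots> \<le> x\<^sup>2 / 36" using x by (simp add: power2_eq_square)
  also have "\<dots> \<le> C" using witness_growth[OF n x] C[OF pos_def_spread] by (rule order_trans)
  finally show False by simp
qed

theorem mainTheorem6:
  shows "(\<forall>n\<ge>5. bounded_ratios n \<subset> nullity_ratios n) \<and> bounded_ratios 5 \<noteq> nullity_ratios 5"
proof -
  have strict: "bounded_ratios n \<subset> nullity_ratios n" if "5 \<le> n" for n
    using witness_ratio witness_homogeneous witness_nullity_nonneg witness_unbounded that
    by (intro bounded_ratios_psubset) auto
  from strict[of 5] strict show ?thesis by auto
qed

end
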